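(* Let $A\in\mathbb{R}^{\tilde r\times(n-m)}$ be the matrix with row vectors $$a_{j,\nu}=(m-1-\nu)!\,\bigl(N_{2m,k}^{(\nu)}(\theta_{\ell_j});\ 1\le k\le n-m\bigr),\qquad 1\le j\le r,\ 0\le\nu\le\mu_j-1,$$ and let $B\in\mathbb{R}^{\tilde r\times(n-m)}$ be the matrix with row vectors $w_{\ell_j,\nu}$ (in the same order of the index pairs $(j,\nu)$). The matrix $A$ has full rank $\tilde r$. Furthermore, every right-inverse $R\in\mathbb{R}^{(n-m)\times\tilde r}$ of $A$ provides a solution $U_m=RB$ of the equation $AU_m=B$.
   Context: Let $m\in\mathbb{N}$ and let $\Theta=\{\theta_1\le\dots\le\theta_{n+m}\}$ be an open knot vector in $[a,b]$: $\theta_1=\dots=\theta_m=a$, $\theta_{n+1}=\dots=\theta_{n+m}=b$, and the interior knots $\theta_k\in(a,b)$, $m+1\le k\le n$, have multiplicity at most $m-1$. B-splines: for $0\le\nu\le m$ and $1\le k\le n-\nu$, $N_{m+\nu,k}(x)=(\theta_{k+m+\nu}-\theta_k)\,[\theta_k,\dots,\theta_{k+m+\nu}\mid(\cdot-x)_+^{m+\nu-1}]$ (divided difference; values at $x=b$ are left limits), $\Phi_{m}=(N_{m,1},\dots,N_{m,n})$ (row vector). $\Gamma=\bigl(\int_a^b N_{m,j}N_{m,k}\,dx\bigr)_{1\le j,k\le n}$ is the Gram matrix of $\Phi_m$. Put $h_{j,k}=(\theta_{k+j}-\theta_k)/j$. For $0\le\nu\le m-1$, $D_{m+\nu}$ is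 the $(n-\nu-1)\times(n-\nu)$ matrix with entries $(D_{m+\nu})_{i,i}=h_{m+\nu,i}^{-1}$, $(D_{m+\nu})_{i,i+1}=-h_{m+\nu,i+1}^{-1}$ and all other entries $0$. The matrix $S\in\mathbb{R}^{n\times n}$ is $$S=U_0+\sum_{\nu=1}^{m-1}D_m^T\cdots D_{m+\nu-1}^T\,U_\nu\,D_{m+\nu-1}\cdots D_m,\qquad U_\nu=\mathrm{diag}(u_k^{(\nu)};1\le k\le n-\nu),$$ $$u_k^{(\nu)}=\frac{m!\,(m-\nu-1)!}{(m+\nu)!\,(m+\nu-1)!}\,h_{m+\nu,k}^{-1}\,F_\nu(\theta_{k+1},\dots,\theta_{k+m+\nu-1}),$$ where $F_0\equiv1$ and, for $\nu\ge1$, $F_\nu(x_1,\dots,x_q)=(2^\nu\nu!)^{-1}\sum\prod_{s=1}^\nu(x_{i_s}-x_{j_s})^2$, the sum running over all $(i_1,\dots,i_\nu,j_1,\dots,j_\nu)$ with pairwise distinct entries in $\{1,\dots,q\}$. Recalled from Chui et al. (2004): $S$ is symmetric with bandwidth $m-1$ (entries $s_{i,j}=0$ for $|i-j|>m-1$), and it is the unique such matrix for which $K(x,y)=\Phi_m(y)S\Phi_m(x)^T$ satisfies $\int_a^b p(y)K(\cdot,y)\,dy=p$ for all polynomials $p$ of degree at most $m-1$. Selected knots: $m+1\le\ell_1<\dots<\ell_r\le n$ are indices of interior knots with $\theta_{\ell_j}>\theta_{\ell_j-1}$ (first occurrence in $\Theta$), $1\le\mu_j\le$ the multiplicity of $\theta_{\ell_j}$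 in $\Theta$, and $\tilde r=\sum_{j=1}^r\mu_j$. The index pairs $(j,\nu)$, $1\le j\le r$, $0\le\nu\le\mu_j-1$, are ordered lexicographically. For an interior knot $\theta_\ell>\theta_{\ell-1}$ and $\nu$ less than its multiplicity, $c_{\ell,\nu}\in\mathbb{R}^n$ is the coefficient vector of the truncated power $(\theta_\ell-x)_+^{m-1-\nu}=\Phi_m(x)c_{\ell,\nu}$; its entries are $\binom{m-1}{\nu}^{-1}\sigma_{m-1-\nu}(\theta_\ell-\theta_{k+1},\dots,\theta_\ell-\theta_{k+m-1})$ for $1\le k\le\ell-m+\nu$ and $0$ for $k>\ell-m+\nu$, with $\sigma_s$ the elementary symmetric polynomial of degree $s$. The row vector $w_{\ell,\nu}\in\mathbb{R}^{n-m}$ is the vector determined by $c_{\ell,\nu}^T(I_n-\Gamma S)=w_{\ell,\nu}D_{2m-1}\cdots D_m$. *)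

theory Defs
  imports
    "HOL-Analysis.Analysis"
    "Jordan_Normal_Form.DL_Rank"
begin

text \<open>A knot vector is a function \<open>\<theta>\<close> of which only the values at \<open>1, \<dots>, n + m\<close> matter.
  Knots, B-splines and all scalar quantities below are indexed from 1; library matrices are indexed
  from 0, so entry \<open>(i, j)\<close> of a library matrix is entry \<open>(i + 1, j + 1)\<close> in the usual notation.\<close>

definition knot_mult :: "nat \<Rightarrow> nat \<Rightarrow> (nat \<Rightarrow> real) \<Rightarrow> real \<Rightarrow> nat" where
  "knot_mult m n \<theta> t = card {i \<in> {1..n + m}. \<theta> i = t}"

definition open_knot_vector :: "nat \<Rightarrow> nat \<Rightarrow> real \<Rightarrow> real \<Rightarrow> (nat \<Rightarrow> real) \<Rightarrow> bool" where
  "open_knot_vector m n a b \<theta> \<longleftrightarrow>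
     1 \<le> m \<and> a < b \<and> mono_on {1..n + m} \<theta> \<and>
     (\<forall>k\<in>{1..m}. \<theta> k = a) \<and> (\<forall>k\<in>{n + 1..n + m}. \<theta> k = b) \<and>
     (\<forall>k\<in>{m + 1..n}. a < \<theta> k \<and> \<theta> k < b \<and> knot_mult m n \<theta> (\<theta> k) \<le> m - 1)"


subsection \<open>Divided differences and B-splines\<close>

text \<open>Left derivatives agree with ordinary derivatives wherever the latter exist. Using them fixes
  the only derivatives of a truncated power that do not exist: those of order \<open>p\<close> of
  \<open>(\<cdot> - x)\<^sub>+\<^sup>p\<close> at \<open>x\<close> become \<open>p! \<cdot> (0)\<^sub>+\<^sup>0 = 0\<close>. This is the usual convention
  making B-splines continuous from the right; for open knot vectors it is only relevant for
  B-splines of order \<open>m\<close> at the end points.\<close>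

definition left_deriv :: "(real \<Rightarrow> real) \<Rightarrow> real \<Rightarrow> real" where
  "left_deriv f t = vector_derivative f (at_left t)"

text \<open>\<open>divdiff \<theta> f k j\<close> is the divided difference of \<open>f\<close> at the nodes
  \<open>\<theta> k \<le> \<dots> \<le> \<theta> (k + j)\<close>. As the nodes are ordered, \<open>\<theta> k = \<theta> (k + j)\<close> means that all of them
  coincide.\<close>

fun divdiff :: "(nat \<Rightarrow> real) \<Rightarrow> (real \<Rightarrow> real) \<Rightarrow> nat \<Rightarrow> nat \<Rightarrow> real" where
  "divdiff \<theta> f k 0 = f (\<theta> k)"
| "divdiff \<theta> f k (Suc j) =
     (if \<theta> (k + Suc j) = \<theta> k then (left_deriv ^^ Suc j) f (\<theta> k) / fact (Suc j)
      else (divdiff \<theta> f (Suc k) j - divdiff \<theta> f k j) / (\<theta> (k + Suc j) - \<theta> k))"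

text \<open>In particular \<open>(0)\<^sub>+\<^sup>0 = 0\<close>.\<close>

definition trunc_pow :: "nat \<Rightarrow> real \<Rightarrow> real" where
  "trunc_pow p y = (if 0 < y then y ^ p else 0)"

definition bspline_raw :: "(nat \<Rightarrow> real) \<Rightarrow> nat \<Rightarrow> nat \<Rightarrow> real \<Rightarrow> real" where
  "bspline_raw \<theta> d k x =
     (\<theta> (k + d) - \<theta> k) * divdiff \<theta> (\<lambda>t. trunc_pow (d - 1) (t - x)) k d"

text \<open>The B-spline \<open>N\<^bsub>d,k\<^esub>\<close> of order \<open>d\<close> on an interval with right end point \<open>b\<close>.\<close>

definition bspline :: "real \<Rightarrow> (nat \<Rightarrow> real) \<Rightarrow> nat \<Rightarrow> nat \<Rightarrow> real \<Rightarrow> real" where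
  "bspline b \<theta> d k x =
     (if x = b then Lim (at_left b) (bspline_raw \<theta> d k) else bspline_raw \<theta> d k x)"

definition gram_mat :: "nat \<Rightarrow> nat \<Rightarrow> real \<Rightarrow> real \<Rightarrow> (nat \<Rightarrow> real) \<Rightarrow> real mat" where
  "gram_mat m n a b \<theta> = Matrix.mat n n
     (\<lambda>(j, k). integral {a..b} (\<lambda>x. bspline b \<theta> m (j + 1) x * bspline b \<theta> m (k + 1) x))"


subsection \<open>The matrix \<open>S\<close>\<close>

definition knot_h :: "(nat \<Rightarrow> real) \<Rightarrow> nat \<Rightarrow> nat \<Rightarrow> real" where
  "knot_h \<theta> j k = (\<theta> (k + j) - \<theta> k) / real j"

text \<open>\<open>diff_mat m n \<theta> \<nu>\<close> is \<open>D\<^bsub>m+\<nu>\<^esub>\<close>, and \<open>diff_prod m n \<theta> \<nu>\<close> is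
  \<open>D\<^bsub>m+\<nu>-1\<^esub> \<cdots> D\<^bsub>m\<^esub>\<close>, of size \<open>(n - \<nu>) \<times> n\<close>.\<close>

definition diff_mat :: "nat \<Rightarrow> nat \<Rightarrow> (nat \<Rightarrow> real) \<Rightarrow> nat \<Rightarrow> real mat" where
  "diff_mat m n \<theta> \<nu> = Matrix.mat (n - \<nu> - 1) (n - \<nu>)
     (\<lambda>(i, j). if j = i then inverse (knot_h \<theta> (m + \<nu>) (i + 1))
               else if j = i + 1 then - inverse (knot_h \<theta> (m + \<nu>) (i + 2))
               else 0)"

primrec diff_prod :: "nat \<Rightarrow> nat \<Rightarrow> (nat \<Rightarrow> real) \<Rightarrow> nat \<Rightarrow> real mat" where
  "diff_prod m n \<theta> 0 = 1\<^sub>m n"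
| "diff_prod m n \<theta> (Suc \<nu>) = diff_mat m n \<theta> \<nu> * diff_prod m n \<theta> \<nu>"

text \<open>\<open>F_poly \<nu> q x\<close> is \<open>F\<^bsub>\<nu>\<^esub>(x\<^bsub>1\<^esub>, \<dots>, x\<^bsub>q\<^esub>)\<close>; the lists \<open>is\<close>, \<open>js\<close> are the index tuples
  \<open>(i\<^bsub>1\<^esub>, \<dots>, i\<^bsub>\<nu>\<^esub>)\<close>, \<open>(j\<^bsub>1\<^esub>, \<dots>, j\<^bsub>\<nu>\<^esub>)\<close>. For \<open>\<nu> = 0\<close> there is exactly one pair
  of empty tuples, so \<open>F\<^bsub>0\<^esub> = 1\<close>.\<close>

definition F_poly :: "nat \<Rightarrow> nat \<Rightarrow> (nat \<Rightarrow> real) \<Rightarrow> real" where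
  "F_poly \<nu> q x = inverse (2 ^ \<nu> * fact \<nu>) *
     (\<Sum>(is, js) \<in> {(is, js). length is = \<nu> \<and> length js = \<nu> \<and> distinct (is @ js) \<and>
                               set (is @ js) \<subseteq> {1..q}}.
        \<Prod>s<\<nu>. (x (is ! s) - x (js ! s))\<^sup>2)"

definition u_coeff :: "nat \<Rightarrow> (nat \<Rightarrow> real) \<Rightarrow> nat \<Rightarrow> nat \<Rightarrow> real" where
  "u_coeff m \<theta> \<nu> k =
     fact m * fact (m - \<nu> - 1) / (fact (m + \<nu>) * fact (m + \<nu> - 1)) *
     inverse (knot_h \<theta> (m + \<nu>) k) * F_poly \<nu> (m + \<nu> - 1) (\<lambda>s. \<theta> (k + s))"

definition U_mat :: "nat \<Rightarrow> nat \<Rightarrow> (nat \<Rightarrow> real) \<Rightarrow> nat \<Rightarrow> real mat" where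
  "U_mat m n \<theta> \<nu> = mat_diag (n - \<nu>) (\<lambda>k. u_coeff m \<theta> \<nu> (k + 1))"

definition S_mat :: "nat \<Rightarrow> nat \<Rightarrow> (nat \<Rightarrow> real) \<Rightarrow> real mat" where
  "S_mat m n \<theta> = U_mat m n \<theta> 0 + Matrix.mat n n
     (\<lambda>(i, j). \<Sum>\<nu> = 1..m - 1.
        (transpose_mat (diff_prod m n \<theta> \<nu>) * U_mat m n \<theta> \<nu> * diff_prod m n \<theta> \<nu>) $$ (i, j))"


subsection \<open>Truncated powers and the matrices \<open>A\<close>, \<open>B\<close>\<close>

text \<open>\<open>elem_sym s q x\<close> is \<open>\<sigma>\<^bsub>s\<^esub>(x\<^bsub>1\<^esub>, \<dots>, x\<^bsub>q\<^esub>)\<close>.\<close>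

definition elem_sym :: "nat \<Rightarrow> nat \<Rightarrow> (nat \<Rightarrow> real) \<Rightarrow> real" where
  "elem_sym s q x = (\<Sum>X \<in> {X. X \<subseteq> {1..q} \<and> card X = s}. \<Prod>i\<in>X. x i)"

text \<open>\<open>c_vec m n \<theta> l \<nu>\<close> is the coefficient vector of \<open>(\<theta> l - x)\<^sub>+\<^sup>m\<^sup>-\<^sup>1\<^sup>-\<^sup>\<nu>\<close> with respect
  to the B-splines of order \<open>m\<close>. The condition on \<open>k\<close> (counted from 0) is
  \<open>k + 1 \<le> l - m + \<nu>\<close>.\<close>

definition c_vec :: "nat \<Rightarrow> nat \<Rightarrow> (nat \<Rightarrow> real) \<Rightarrow> nat \<Rightarrow> nat \<Rightarrow> real Matrix.vec" where
  "c_vec m n \<theta> l \<nu> = Matrix.vec n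
     (\<lambda>k. if k + 1 + m \<le> l + \<nu>
          then inverse (of_nat ((m - 1) choose \<nu>)) *
               elem_sym (m - 1 - \<nu>) (m - 1) (\<lambda>i. \<theta> l - \<theta> (k + 1 + i))
          else 0)"

definition w_vec ::
    "nat \<Rightarrow> nat \<Rightarrow> real \<Rightarrow> real \<Rightarrow> (nat \<Rightarrow> real) \<Rightarrow> nat \<Rightarrow> nat \<Rightarrow> real Matrix.vec" where
  "w_vec m n a b \<theta> l \<nu> = (THE w. w \<in> carrier_vec (n - m) \<and>
     mat_of_rows n [c_vec m n \<theta> l \<nu>] * (1\<^sub>m n - gram_mat m n a b \<theta> * S_mat m n \<theta>) =
     mat_of_rows (n - m) [w] * diff_prod m n \<theta> m)"

text \<open>The knots \<open>\<theta> (l j)\<close>, \<open>1 \<le> j \<le> r\<close>, are the selected ones and \<open>\<mu> j\<close> is the number of rows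
  attached to the \<open>j\<close>-th of them.\<close>

definition selected_knots ::
    "nat \<Rightarrow> nat \<Rightarrow> (nat \<Rightarrow> real) \<Rightarrow> nat \<Rightarrow> (nat \<Rightarrow> nat) \<Rightarrow> (nat \<Rightarrow> nat) \<Rightarrow> bool" where
  "selected_knots m n \<theta> r l \<mu> \<longleftrightarrow>
     strict_mono_on {1..r} l \<and>
     (\<forall>j\<in>{1..r}. m + 1 \<le> l j \<and> l j \<le> n \<and> \<theta> (l j - 1) < \<theta> (l j) \<and>
                 1 \<le> \<mu> j \<and> \<mu> j \<le> knot_mult m n \<theta> (\<theta> (l j)))"

definition index_pairs :: "nat \<Rightarrow> (nat \<Rightarrow> nat) \<Rightarrow> (nat \<times> nat) list" where
  "index_pairs r \<mu> = [(j, \<nu>). j \<leftarrow> [1..<r + 1], \<nu> \<leftarrow> [0..<\<mu> j]]"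

definition A_mat ::
    "nat \<Rightarrow> nat \<Rightarrow> real \<Rightarrow> (nat \<Rightarrow> real) \<Rightarrow> nat \<Rightarrow> (nat \<Rightarrow> nat) \<Rightarrow> (nat \<Rightarrow> nat) \<Rightarrow> real mat" where
  "A_mat m n b \<theta> r l \<mu> = mat_of_rows (n - m)
     (map (\<lambda>(j, \<nu>). Matrix.vec (n - m)
             (\<lambda>k. fact (m - 1 - \<nu>) * (deriv ^^ \<nu>) (bspline b \<theta> (2 * m) (k + 1)) (\<theta> (l j))))
          (index_pairs r \<mu>))"

definition B_mat ::
    "nat \<Rightarrow> nat \<Rightarrow> real \<Rightarrow> real \<Rightarrow> (nat \<Rightarrow> real) \<Rightarrow> nat \<Rightarrow> (nat \<Rightarrow> nat) \<Rightarrow> (nat \<Rightarrow> nat) \<Rightarrow> real mat" where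
  "B_mat m n a b \<theta> r l \<mu> = mat_of_rows (n - m)
     (map (\<lambda>(j, \<nu>). w_vec m n a b \<theta> (l j) \<nu>) (index_pairs r \<mu>))"

lemma length_index_pairs: "length (index_pairs r \<mu>) = (\<Sum>j = 1..r. \<mu> j)"
proof -
  have "length (index_pairs r \<mu>) = sum_list (map \<mu> [1..<r + 1])"
    by (simp add: index_pairs_def length_concat o_def)
  also have "\<dots> = (\<Sum>j = 1..r. \<mu> j)"
    by (simp add: interv_sum_list_conv_sum_set_nat atLeastLessThanSuc_atLeastAtMost del: upt_Suc)
  finally show ?thesis .
qed

lemma A_mat_carrier: "A_mat m n b \<theta> r l \<mu> \<in> carrier_mat (\<Sum>j = 1..r. \<mu> j) (n - m)"
  unfolding A_mat_def carrier_mat_def by (simp add: length_index_pairs)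

lemma B_mat_carrier: "B_mat m n a b \<theta> r l \<mu> \<in> carrier_mat (\<Sum>j = 1..r. \<mu> j) (n - m)"
  unfolding B_mat_def carrier_mat_def by (simp add: length_index_pairs)

end

theory Submission
  imports Defs
begin

text \<open>A row vector annihilating \<open>A\<close> gives a combination \<open>G\<close> of truncated powers
  \<open>(\<cdot> - \<tau>)\<^sub>+\<^sup>2\<^sup>m\<^sup>-\<^sup>1\<^sup>-\<^sup>\<nu>\<close> all of whose divided differences of order \<open>2m\<close> over consecutive
  knots vanish. Hence a polynomial \<open>P\<close> of degree less than \<open>2m\<close> interpolates \<open>G\<close> at all knots with
  multiplicity. Integrating by parts piecewise, the Hermite zeros of \<open>H = G - P\<close> at the end points
  (order \<open>m\<close>) and at the selected knots kill all boundary terms of the integral of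
  \<open>(H\<^sup>(\<^sup>m\<^sup>))\<^sup>2\<close>, so \<open>H\<close> is zero, and all its jumps vanish. The equation \<open>A(RB) = B\<close> is then just
  associativity.\<close>

unbundle no vec_syntax

subsection \<open>Left derivatives\<close>

text \<open>\<open>vector_derivative\<close> is junk where no derivative exists, so it is linear only on classes of
  functions with all left derivatives, such as the following one.\<close>

definition left_poly :: "(real \<Rightarrow> real) \<Rightarrow> bool" where
  "left_poly f \<longleftrightarrow> (\<forall>t. \<exists>u<t. \<exists>p. \<forall>s\<in>{u<..t}. f s = poly p s)"

text \<open>\<open>vector_derivative\<close> is a choice over the relation
  \<open>has_vector_derivative\<close>. Agreement on a left neighbourhood including \<open>t\<close>
  makes these relations equal for every \<open>D\<close>, so the chosen values coincide even where
  no derivative exists.\<close>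

lemma left_deriv_cong:
  assumes "u < t" "\<And>s. s \<in> {u<..t} \<Longrightarrow> f s = g s"
  shows "left_deriv f t = left_deriv g t"
proof -
  have "eventually (\<lambda>s. s > u) (nhds t)"
    using assms(1) by (rule order_tendstoD[OF filterlim_ident])
  then have "\<forall>\<^sub>F x in nhds t. x \<in> {..<t} \<longrightarrow> f x = g x"
    by eventually_elim (use assms(2) in auto)
  then have "(f has_vector_derivative D) (at_left t) = (g has_vector_derivative D) (at_left t)" for D
    by (rule has_vector_derivative_cong_ev) (use assms in auto)
  then show ?thesis
    by (simp add: left_deriv_def vector_derivative_def)
qed

lemma left_deriv_funpow_cong:
  assumes "u < t" "\<And>s. s \<in> {u<..t} \<Longrightarrow> f s = g s"
  shows "(left_deriv ^^ j) f t = (left_deriv ^^ j) g t"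
proof -
  \<comment> \<open>The induction has to carry agreement on the whole interval: the next left
    derivative at a point looks at values to its left.\<close>
  have "\<forall>s\<in>{u<..t}. (left_deriv ^^ j) f s = (left_deriv ^^ j) g s"
  proof (induction j)
    case (Suc j)
    show ?case
    proof
      fix s assume "s \<in> {u<..t}"
      then show "(left_deriv ^^ Suc j) f s = (left_deriv ^^ Suc j) g s"
        using Suc by (auto intro: left_deriv_cong[of u])
    qed
  qed (use assms in auto)
  then show ?thesis using assms by auto
qed

lemma left_deriv_poly: "left_deriv (poly p) = poly (pderiv p)"
proof
  fix t
  have "(poly p has_vector_derivative poly (pderiv p) t) (at_left t)"
    using poly_DERIV[of p t] has_vector_derivative_at_within
    by (auto simp: has_real_derivative_iff_has_vector_derivative)
  then show "left_deriv (poly p) t = poly (pderiv p) t"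
    unfolding left_deriv_def by (rule vector_derivative_within[OF trivial_limit_at_left_real])
qed

lemma left_deriv_funpow_poly: "(left_deriv ^^ j) (poly p) = poly ((pderiv ^^ j) p)"
  by (induction j) (simp_all add: left_deriv_poly)

lemma left_deriv_funpow_eq_poly:
  assumes "u < t" "\<And>s. s \<in> {u<..t} \<Longrightarrow> f s = poly p s"
  shows "(left_deriv ^^ j) f t = poly ((pderiv ^^ j) p) t"
  using left_deriv_funpow_cong[OF assms] by (simp add: left_deriv_funpow_poly)

text \<open>On a common left neighbourhood of each point both functions are polynomials, so the
  claim reduces to the linearity of \<open>pderiv\<close>.\<close>

lemma left_poly_linear:
  assumes "left_poly f" "left_poly g"
  shows "left_poly (\<lambda>t. c * f t + g t)"
    and "(left_deriv ^^ j) (\<lambda>t. c * f t + g t) t = c * (left_deriv ^^ j) f t + (left_deriv ^^ j) g t"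
proof -
  have *: "\<exists>u<t. \<exists>p q. \<forall>s\<in>{u<..t}. f s = poly p s \<and> g s = poly q s" for t
  proof -
    obtain u p where u: "u < t" "\<forall>s\<in>{u<..t}. f s = poly p s"
      using assms(1) unfolding left_poly_def by blast
    obtain v q where v: "v < t" "\<forall>s\<in>{v<..t}. g s = poly q s"
      using assms(2) unfolding left_poly_def by blast
    show ?thesis
      by (rule exI[of _ "max u v"]) (use u v in auto)
  qed
  show "left_poly (\<lambda>t. c * f t + g t)"
    unfolding left_poly_def
  proof
    fix t
    obtain u p q where "u < t" "\<forall>s\<in>{u<..t}. f s = poly p s \<and> g s = poly q s"
      using *[of t] by blast
    then show "\<exists>u<t. \<exists>p. \<forall>s\<in>{u<..t}. c * f s + g s = poly p s"
      by (intro exI[of _ u] conjI exI[of _ "Polynomial.smult c p + q"]) auto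
  qed
  obtain u p q where u: "u < t" "\<forall>s\<in>{u<..t}. f s = poly p s \<and> g s = poly q s"
    using *[of t] by blast
  have "(left_deriv ^^ j) (\<lambda>t. c * f t + g t) t = poly ((pderiv ^^ j) (Polynomial.smult c p + q)) t"
    by (rule left_deriv_funpow_eq_poly[of u]) (use u in auto)
  moreover have "(left_deriv ^^ j) f t = poly ((pderiv ^^ j) p) t"
    by (rule left_deriv_funpow_eq_poly[of u]) (use u in auto)
  moreover have "(left_deriv ^^ j) g t = poly ((pderiv ^^ j) q) t"
    by (rule left_deriv_funpow_eq_poly[of u]) (use u in auto)
  ultimately show "(left_deriv ^^ j) (\<lambda>t. c * f t + g t) t
      = c * (left_deriv ^^ j) f t + (left_deriv ^^ j) g t"
    by (simp add: higher_pderiv_smult higher_pderiv_add)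
qed

lemma left_poly_poly: "left_poly (poly p)"
  unfolding left_poly_def by (metis lt_ex)

lemma left_poly_zero: "left_poly (\<lambda>t. 0)"
  unfolding left_poly_def by (metis lt_ex poly_0)

lemma left_poly_trunc_pow: "left_poly (\<lambda>t. trunc_pow p (t - x))"
  unfolding left_poly_def
proof
  fix t
  show "\<exists>u<t. \<exists>q. \<forall>s\<in>{u<..t}. trunc_pow p (s - x) = poly q s"
  proof (cases "x < t")
    case True
    then show ?thesis
      by (intro exI[of _ x] conjI exI[of _ "[:-x, 1:] ^ p"]) (auto simp: trunc_pow_def)
  next
    case False
    then show ?thesis
      by (intro exI[of _ "t - 1"] conjI exI[of _ 0]) (auto simp: trunc_pow_def)
  qed
qed

lemma left_poly_sum:
  "finite I \<Longrightarrow> (\<And>i. i \<in> I \<Longrightarrow> left_poly (f i)) \<Longrightarrow> left_poly (\<lambda>t. \<Sum>i\<in>I. c i * f i t)"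
proof (induction I rule: finite_induct)
  case empty
  then show ?case using left_poly_zero by simp
next
  case (insert i I)
  then show ?case
    using left_poly_linear(1)[of "f i" "\<lambda>t. \<Sum>i\<in>I. c i * f i t" "c i"] by simp
qed

section \<open>Derivatives of products with, and powers of, a linear factor\<close>

lemma pderiv_linear_mult: "pderiv ([:-c, 1:] * q) = [:-c, 1:] * pderiv q + (q :: real poly)"
  by (simp add: pderiv_mult pderiv_pCons del: mult_pCons_left mult_pCons_right)

text \<open>Leibniz rule with a linear factor: only two terms survive. It settles the confluent case
  of \<open>divdiff_linear_mult\<close>.\<close>

lemma pderiv_funpow_linear_mult:
  "(pderiv ^^ Suc N) ([:-c, 1:] * q)
    = [:-c, 1:] * (pderiv ^^ Suc N) q + Polynomial.smult (real (Suc N)) ((pderiv ^^ N) q)"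
proof (induction N)
  case 0
  show ?case using pderiv_linear_mult[of c q] by (simp del: mult_pCons_left mult_pCons_right)
next
  case (Suc N)
  have "(pderiv ^^ Suc (Suc N)) ([:-c, 1:] * q) = pderiv ((pderiv ^^ Suc N) ([:-c, 1:] * q))"
    by simp
  also have "\<dots> = [:-c, 1:] * pderiv ((pderiv ^^ Suc N) q) + (pderiv ^^ Suc N) q
      + Polynomial.smult (real (Suc N)) (pderiv ((pderiv ^^ N) q))"
    unfolding Suc pderiv_add pderiv_linear_mult pderiv_smult ..
  also have "\<dots> = [:-c, 1:] * (pderiv ^^ Suc (Suc N)) q
      + (Polynomial.smult 1 ((pderiv ^^ Suc N) q) + Polynomial.smult (real (Suc N)) ((pderiv ^^ Suc N) q))"
    by (simp del: mult_pCons_left mult_pCons_right)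
  finally show ?case
    unfolding smult_add_left[symmetric] by simp
qed

lemma pderiv_funpow_linear_power:
  "j \<le> p \<Longrightarrow> (pderiv ^^ j) ([:-x, 1:] ^ p) = Polynomial.smult (fact p / fact (p - j)) ([:-x, 1:] ^ (p - j) :: real poly)"
proof (induction j)
  case (Suc j)
  then have "p - j = Suc (p - Suc j)" by simp
  then have "fact (p - j) = real (p - j) * fact (p - Suc j)"
    by (metis fact_Suc of_nat_mult of_nat_fact)
  moreover have "pderiv ([:-x, 1:] ^ (p - j)) = Polynomial.smult (real (p - j)) ([:-x, 1:] ^ (p - Suc j))"
    using pderiv_power_Suc[of "[:-x,1:]" "p - Suc j"] \<open>p - j = Suc (p - Suc j)\<close>
    by (simp add: pderiv_pCons)
  ultimately show ?case
    using Suc by (simp add: pderiv_smult)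
qed simp

text \<open>For \<open>t \<le> x\<close> the function agrees with the zero polynomial to the left of
  and at \<open>t\<close>, so the formula also holds for \<open>j = p\<close> and
  \<open>t = x\<close>, where it relies on \<open>trunc_pow 0 0 = 0\<close>.\<close>

lemma left_deriv_funpow_trunc_pow:
  assumes "j \<le> p"
  shows "(left_deriv ^^ j) (\<lambda>t. trunc_pow p (t - x)) t
    = fact p / fact (p - j) * trunc_pow (p - j) (t - x)"
proof (cases "x < t")
  case True
  have "(left_deriv ^^ j) (\<lambda>t. trunc_pow p (t - x)) t = poly ((pderiv ^^ j) ([:-x, 1:] ^ p)) t"
    by (rule left_deriv_funpow_eq_poly[of x]) (use True in \<open>auto simp: trunc_pow_def\<close>)
  then show ?thesis
    using True assms by (simp add: pderiv_funpow_linear_power trunc_pow_def)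
next
  case False
  have "(left_deriv ^^ j) (\<lambda>t. trunc_pow p (t - x)) t = poly ((pderiv ^^ j) 0) t"
    by (rule left_deriv_funpow_eq_poly[of "t - 1"]) (use False in \<open>auto simp: trunc_pow_def\<close>)
  then show ?thesis
    using False by (simp add: trunc_pow_def)
qed

subsection \<open>Divided differences\<close>

lemma divdiff_linear:
  assumes "left_poly f" "left_poly g"
  shows "divdiff \<theta> (\<lambda>t. c * f t + g t) k j = c * divdiff \<theta> f k j + divdiff \<theta> g k j"
proof (induction j arbitrary: k)
  case (Suc j)
  show ?case
    using left_poly_linear(2)[OF assms, of "Suc j" c "\<theta> k"]
    by (simp add: Suc add_divide_distrib[symmetric] right_diff_distrib del: funpow.simps fact_Suc)
qed simp

lemma divdiff_zero: "divdiff \<theta> (\<lambda>t. 0) k j = 0"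
  \<comment> \<open>With \<open>c = -1\<close> linearity reads d = -d + d.\<close>
  using divdiff_linear[OF left_poly_zero left_poly_zero, of \<theta> "-1" k j] by simp

lemma divdiff_sum:
  assumes "finite I" "\<And>i. i \<in> I \<Longrightarrow> left_poly (f i)"
  shows "divdiff \<theta> (\<lambda>t. \<Sum>i\<in>I. c i * f i t) k j = (\<Sum>i\<in>I. c i * divdiff \<theta> (f i) k j)"
  using assms
proof (induction I rule: finite_induct)
  case empty
  then show ?case by (simp add: divdiff_zero)
next
  case (insert i I)
  then show ?case
    using divdiff_linear[of "f i" "\<lambda>t. \<Sum>i\<in>I. c i * f i t" \<theta> "c i" k j] left_poly_sum[of I f c]
    by simp
qed

lemma divdiff_confluent:
  "\<theta> (k + j) = \<theta> k \<Longrightarrow> divdiff \<theta> f k j = (left_deriv ^^ j) f (\<theta> k) / fact j"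
  by (cases j) auto

text \<open>The recursion without division, valid for confluent nodes too: if the outer nodes
  coincide, monotonicity squeezes all nodes together and both sides are the same derivative.\<close>

lemma divdiff_step:
  assumes "mono_on {lo..hi} \<theta>" "lo \<le> k" "k + Suc j \<le> hi"
  shows "divdiff \<theta> f (Suc k) j
    = divdiff \<theta> f k j + (\<theta> (k + Suc j) - \<theta> k) * divdiff \<theta> f k (Suc j)"
proof (cases "\<theta> (k + Suc j) = \<theta> k")
  case True
  have "\<theta> k \<le> \<theta> (Suc k)" "\<theta> (Suc k) \<le> \<theta> (k + Suc j)" "\<theta> k \<le> \<theta> (k + j)" "\<theta> (k + j) \<le> \<theta> (k + Suc j)"
    by (rule mono_onD[OF assms(1)]; use assms in simp)+
  then show ?thesis
    using True by (simp add: divdiff_confluent)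
qed simp

text \<open>Leibniz rule for divided differences with a linear factor. It drives both the inductions
  on the degree and the evaluation of the Newton basis.\<close>

lemma divdiff_linear_mult:
  assumes "mono_on {lo..hi} \<theta>" "lo \<le> k" "k + Suc j \<le> hi"
  shows "divdiff \<theta> (poly ([:-c, 1:] * g)) k (Suc j)
    = (\<theta> k - c) * divdiff \<theta> (poly g) k (Suc j) + divdiff \<theta> (poly g) (Suc k) j"
  using assms(2,3)
proof (induction j arbitrary: k)
  case 0
  show ?case
  proof (cases "\<theta> (Suc k) = \<theta> k")
    case True
    have "pderiv ([:-c, 1:] * g) = [:-c, 1:] * pderiv g + g"
      by (rule pderiv_linear_mult)
    then have "left_deriv (poly ([:-c, 1:] * g)) (\<theta> k)
        = (\<theta> k - c) * poly (pderiv g) (\<theta> k) + poly g (\<theta> k)"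
      unfolding left_deriv_poly by (simp only:) (simp add: algebra_simps)
    moreover have "divdiff \<theta> f k (Suc 0) = left_deriv f (\<theta> k)" for f
      using True by simp
    ultimately show ?thesis
      by (simp only: divdiff.simps(1) left_deriv_poly[of g] True)
  next
    case False
    then show ?thesis by (simp add: field_simps)
  qed
next
  case (Suc j)
  show ?case
  proof (cases "\<theta> (k + Suc (Suc j)) = \<theta> k")
    case True
    have "\<theta> k \<le> \<theta> (Suc k)" "\<theta> (Suc k) \<le> \<theta> (k + Suc (Suc j))"
      by (rule mono_onD[OF assms(1)]; use Suc in simp)+
    then have eq: "\<theta> (Suc k) = \<theta> k" using True by simp
    have 1: "divdiff \<theta> (poly q) k (Suc (Suc j))
        = poly ((pderiv ^^ Suc (Suc j)) q) (\<theta> k) / fact (Suc (Suc j))" for q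
      using divdiff_confluent[OF True] by (simp only: left_deriv_funpow_poly)
    have 2: "divdiff \<theta> (poly g) (Suc k) (Suc j)
        = poly ((pderiv ^^ Suc j) g) (\<theta> k) / fact (Suc j)"
      using divdiff_confluent[of \<theta> "Suc k" "Suc j"] True eq by (simp add: left_deriv_funpow_poly del: funpow.simps)
    have f: "fact (Suc (Suc j)) = real (Suc (Suc j)) * fact (Suc j)" by simp
    show ?thesis
      unfolding 1 2 pderiv_funpow_linear_mult f by (simp add: divide_simps del: fact_Suc funpow.simps of_nat_Suc) (simp add: algebra_simps)
  next
    case False
    let ?d = "divdiff \<theta> (poly g)" and ?e = "divdiff \<theta> (poly ([:-c, 1:] * g))"
    have IH1: "?e (Suc k) (Suc j) = (\<theta> (Suc k) - c) * ?d (Suc k) (Suc j) + ?d (Suc (Suc k)) j"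
      by (rule Suc.IH) (use Suc.prems in auto)
    have IH2: "?e k (Suc j) = (\<theta> k - c) * ?d k (Suc j) + ?d (Suc k) j"
      by (rule Suc.IH) (use Suc.prems in auto)
    have s1: "?d (Suc (Suc k)) j = ?d (Suc k) j + (\<theta> (Suc k + Suc j) - \<theta> (Suc k)) * ?d (Suc k) (Suc j)"
      by (rule divdiff_step[OF assms(1)]) (use Suc.prems in auto)
    have s2: "?d (Suc k) (Suc j) = ?d k (Suc j) + (\<theta> (k + Suc (Suc j)) - \<theta> k) * ?d k (Suc (Suc j))"
      by (rule divdiff_step[OF assms(1)]) (use Suc.prems in auto)
    have s3: "?e (Suc k) (Suc j) = ?e k (Suc j) + (\<theta> (k + Suc (Suc j)) - \<theta> k) * ?e k (Suc (Suc j))"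
      by (rule divdiff_step[OF assms(1)]) (use Suc.prems in auto)
    define D where "D = \<theta> (k + Suc (Suc j)) - \<theta> k"
    have D: "\<theta> (k + Suc (Suc j)) = \<theta> k + D" "\<theta> (Suc k + Suc j) = \<theta> k + D" "D \<noteq> 0"
      using False by (auto simp: D_def)
    \<comment> \<open>Multiplied by the nonzero node distance \<open>D\<close>, the claim is a
      polynomial identity in the lower-order differences.\<close>
    have "D * ?e k (Suc (Suc j)) = ?e (Suc k) (Suc j) - ?e k (Suc j)"
      using s3 D by simp
    also have "\<dots> = (\<theta> k + D - c) * ?d (Suc k) (Suc j) - (\<theta> k - c) * ?d k (Suc j)"
      unfolding IH1 IH2 s1 D by (simp only: algebra_simps)
    also have "\<dots> = D * ((\<theta> k - c) * ?d k (Suc (Suc j)) + ?d (Suc k) (Suc j))"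
      unfolding s2 unfolding D by (simp add: algebra_simps del: divdiff.simps)
    finally show ?thesis by (simp only: mult_left_cancel[OF D(3)])
  qed
qed

section \<open>Divided differences of polynomials and Newton interpolation\<close>

lemma divdiff_one: "divdiff \<theta> (poly 1) k j = (if j = 0 then 1 else 0)"
proof (induction j arbitrary: k)
  case (Suc j)
  have "(pderiv ^^ Suc j) 1 = (0 :: real poly)"
    by (simp add: funpow_Suc_right del: funpow.simps)
  then show ?case
    using Suc by (simp add: left_deriv_funpow_poly del: funpow.simps poly_1)
qed simp

lemma divdiff_poly_zero:
  assumes "mono_on {lo..hi} \<theta>" "lo \<le> k" "k + j \<le> hi" "degree p < j"
  shows "divdiff \<theta> (poly p) k j = 0"
  using assms(2-4)
proof (induction p arbitrary: j k)
  case 0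
  have "poly 0 = (\<lambda>t. 0 :: real)" by (rule ext) simp
  then show ?case by (simp only: divdiff_zero)
next
  case (pCons a p)
  obtain i where j: "j = Suc i" using pCons by (cases j) auto
  \<comment> \<open>The variable is written as \<open>[:-0, 1:]\<close> so that the Leibniz rule
    applies with \<open>c = 0\<close>.\<close>
  have eq: "poly (pCons a p) = (\<lambda>t. a * poly 1 t + poly ([:-0, 1:] * p) t)"
    by (rule ext) simp
  have "divdiff \<theta> (poly (pCons a p)) k j
      = a * divdiff \<theta> (poly 1) k j + divdiff \<theta> (poly ([:-0, 1:] * p)) k j"
    unfolding eq by (rule divdiff_linear) (rule left_poly_poly)+
  also have "\<dots> = \<theta> k * divdiff \<theta> (poly p) k j + divdiff \<theta> (poly p) (Suc k) i"
    using divdiff_linear_mult[OF assms(1), of k i 0 p] pCons.prems unfolding j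
    by (simp only: divdiff_one) simp
  also have "\<dots> = 0"
  \<comment> \<open>Passing from \<open>pCons a p\<close> to \<open>p\<close> lowers the degree only
    if \<open>p\<close> is nonzero.\<close>
  proof (cases "p = 0")
    case True
    have "poly p = (\<lambda>t. 0)" using True by (intro ext) simp
    then show ?thesis by (simp only: divdiff_zero)
next
    case False
    then show ?thesis
      using pCons.IH[of k j] pCons.IH[of "Suc k" i] pCons.prems j by simp
  qed
  finally show ?case .
qed

text \<open>Splitting off the factor at the first node makes the first Leibniz term vanish; what
  remains is the same statement for the shifted nodes with both indices lowered by one.\<close>

lemma divdiff_newton_basis:
  assumes "mono_on {lo..hi} \<theta>" "lo \<le> k" "k + j \<le> hi" "j \<le> i"
  shows "divdiff \<theta> (poly (\<Prod>s<i. [:-\<theta> (k + s), 1:])) k j = (if i = j then 1 else 0)"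
  using assms(2-4)
proof (induction i arbitrary: j k)
  case 0
  then show ?case using divdiff_one[of \<theta> k j] by simp
next
  case (Suc i)
  have eq: "(\<Prod>s<Suc i. [:-\<theta> (k + s), 1:]) = [:-\<theta> k, 1:] * (\<Prod>s<i. [:-\<theta> (Suc k + s), 1:])"
    by (subst prod.lessThan_Suc_shift) simp
  show ?case
  proof (cases j)
    case 0
    then show ?thesis unfolding eq by simp
  next
    case (Suc j')
    then show ?thesis
      unfolding eq Suc using Suc.IH[of "Suc k" j'] Suc.prems \<open>j = Suc j'\<close>
      by (subst divdiff_linear_mult[OF assms(1)]) simp_all
  qed
qed

text \<open>Hermite interpolation, with the data given as divided differences at the initial nodes.
  Adding a multiple of the next Newton polynomial leaves the lower differences unchanged.\<close>

lemma newton_interpolation: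
  assumes "mono_on {lo..hi} \<theta>" "lo \<le> k" "k + d \<le> hi"
  shows "\<exists>P. degree P \<le> d \<and> (\<forall>i\<le>d. divdiff \<theta> (poly P) k i = e i)"
  using assms(3)
proof (induction d)
  case 0
  show ?case by (rule exI[of _ "[:e 0:]"]) simp
next
  case (Suc d)
  then obtain P where P: "degree P \<le> d" "\<And>i. i \<le> d \<Longrightarrow> divdiff \<theta> (poly P) k i = e i" by auto
  define w where "w = (\<Prod>s<Suc d. [:-\<theta> (k + s), 1:])"
  \<comment> \<open>The next Newton polynomial has difference 1 of order \<open>Suc d\<close>, so
    \<open>c\<close> is exactly the missing amount.\<close>
  define c where "c = e (Suc d) - divdiff \<theta> (poly P) k (Suc d)"
  have "degree w \<le> Suc d"
    unfolding w_def using degree_prod_sum_le[of "{..<Suc d}" "\<lambda>s. [:-\<theta> (k + s), 1:]"] by simp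
  then have "degree (Polynomial.smult c w + P) \<le> Suc d"
    using P(1) by (intro degree_add_le) (auto intro: order_trans[OF degree_smult_le])
  moreover have "divdiff \<theta> (poly (Polynomial.smult c w + P)) k i = e i" if "i \<le> Suc d" for i
  proof -
    have "divdiff \<theta> (poly (Polynomial.smult c w + P)) k i
        = divdiff \<theta> (\<lambda>t. c * poly w t + poly P t) k i"
      by (rule arg_cong[of _ _ "\<lambda>f. divdiff \<theta> f k i"]) auto
    also have "\<dots> = c * divdiff \<theta> (poly w) k i + divdiff \<theta> (poly P) k i"
      by (rule divdiff_linear) (rule left_poly_poly)+
    also have "divdiff \<theta> (poly w) k i = (if Suc d = i then 1 else 0)"
      unfolding w_def by (rule divdiff_newton_basis[OF assms(1,2)]) (use that Suc.prems in auto)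
    finally show ?thesis
      using P(2)[of i] that
      by (cases "i = Suc d") (auto simp: c_def simp del: divdiff.simps(2) poly_add poly_smult)
  qed
  ultimately show ?case by blast
qed

text \<open>Descending induction on the order: once all differences of order \<open>Suc i\<close>
  vanish, \<open>divdiff_step\<close> makes those of order \<open>i\<close> independent of the
  starting index, and the one at \<open>lo\<close> is zero.\<close>

lemma divdiff_zero_propagate:
  assumes "mono_on {lo..hi} \<theta>"
    and lo: "\<And>i. i < d \<Longrightarrow> divdiff \<theta> f lo i = 0"
    and top: "\<And>k. lo \<le> k \<Longrightarrow> k + d \<le> hi \<Longrightarrow> divdiff \<theta> f k d = 0"
    and "i \<le> d" "lo \<le> k" "k + i \<le> hi"
  shows "divdiff \<theta> f k i = 0"
  using \<open>i \<le> d\<close> \<open>lo \<le> k\<close> \<open>k + i \<le> hi\<close>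
proof (induction i arbitrary: k rule: inc_induct)
  case base
  then show ?case using top by simp
next
  case (step i)
  from \<open>lo \<le> k\<close> \<open>k + i \<le> hi\<close> show ?case
  proof (induction k rule: dec_induct)
    case base
    then show ?case using lo step by simp
  next
    case (step k)
    then show ?case
      using divdiff_step[OF assms(1), of k i f] step.IH \<open>\<And>k. lo \<le> k \<Longrightarrow> k + Suc i \<le> hi \<Longrightarrow> divdiff \<theta> f k (Suc i) = 0\<close>
      by simp
  qed
qed

subsection \<open>The energy argument\<close>

lemma poly_eq_0_on_interval:
  fixes p :: "real poly"
  assumes "u < v" "\<And>x. u < x \<Longrightarrow> x < v \<Longrightarrow> poly p x = 0"
  shows "p = 0"
proof (rule ccontr)
  assume "p \<noteq> 0"
  then have "finite {x. poly p x = 0}" by (rule poly_roots_finite)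
  moreover have "{u<..<v} \<subseteq> {x. poly p x = 0}" using assms by auto
  ultimately show False using assms(1) infinite_Ioo finite_subset by blast
qed

lemma poly_mono_of_pderiv_square:
  fixes W q :: "real poly"
  assumes "pderiv W = q\<^sup>2" "u \<le> v"
  shows "poly W u \<le> poly W v"
proof (rule DERIV_nonneg_imp_nondecreasing[OF assms(2)])
  fix x
  have "DERIV (poly W) x :> poly (q\<^sup>2) x" using poly_DERIV[of W x] by (simp only: assms(1))
  moreover have "0 \<le> poly (q\<^sup>2) x" by simp
  ultimately show "\<exists>y. DERIV (poly W) x :> y \<and> 0 \<le> y" by blast
qed

text \<open>\<open>W\<close> is nondecreasing with equal end values, hence constant on the interval
  and therefore everywhere.\<close>

lemma pderiv_square_eq_0:
  fixes W q :: "real poly"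
  assumes "pderiv W = q\<^sup>2" "u < v" "poly W u = poly W v"
  shows "q = 0"
proof -
  have "W - [:poly W u:] = 0"
  proof (rule poly_eq_0_on_interval[OF assms(2)])
    fix x assume "u < x" "x < v"
    then have "poly W u \<le> poly W x" "poly W x \<le> poly W v"
      using poly_mono_of_pderiv_square[OF assms(1)] by auto
    then show "poly (W - [:poly W u:]) x = 0" using assms(3) by simp
  qed
  then have "W = [:poly W u:]" by simp
  then have "pderiv W = 0" by (metis pderiv_pCons pderiv_0 pCons_0_0 add_0)
  then show ?thesis using assms(1) by simp
qed

lemma higher_pderiv_eq_0_degree: "degree p < j \<Longrightarrow> (pderiv ^^ j) p = (0 :: real poly)"
  by (rule poly_eqI) (simp add: coeff_higher_pderiv coeff_eq_0)

lemma pderiv_funpow_eq_0_imp_eq_0: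
  fixes p :: "real poly"
  assumes "(pderiv ^^ j) p = 0" "\<And>s. s < j \<Longrightarrow> poly ((pderiv ^^ s) p) t = 0"
  shows "p = 0"
  using assms
proof (induction j arbitrary: p)
  case (Suc j)
  have "pderiv p = 0"
  proof (rule Suc.IH)
    show "(pderiv ^^ j) (pderiv p) = 0"
      using Suc.prems(1) by (simp add: funpow_Suc_right del: funpow.simps)
    show "poly ((pderiv ^^ s) (pderiv p)) t = 0" if "s < j" for s
      using Suc.prems(2)[of "Suc s"] that by (simp add: funpow_Suc_right del: funpow.simps)
  qed
  then obtain c where "p = [:c:]"
    by (auto simp: pderiv_eq_0_iff elim: degree_eq_zeroE)
  then show ?case using Suc.prems(2)[of 0] by simp
qed simp

lemma linear_power_dvd_imp_pderiv_funpow: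
  assumes "[:-t, 1:] ^ e dvd q" "s < e"
  shows "poly ((pderiv ^^ s) q) t = (0 :: real)"
  using assms
proof (induction s arbitrary: q e)
  case 0
  then show ?case by (cases e) auto
next
  case (Suc s)
  then obtain e' where e: "e = Suc e'" by (cases e) auto
  obtain r where "q = [:-t, 1:] ^ Suc e' * r" using Suc.prems(1) e by (auto simp: dvd_def)
  then have "pderiv q = [:-t, 1:] ^ e' * ([:-t, 1:] * pderiv r)
      + Polynomial.smult (of_nat (Suc e')) ([:-t, 1:] ^ e') * pderiv [:-t, 1:] * r"
    by (simp only: pderiv_mult pderiv_power_Suc) (simp only: power_Suc ac_simps)
  then have "[:-t, 1:] ^ e' dvd pderiv q"
    by (simp only:) (intro dvd_add dvd_mult2 dvd_smult dvd_refl)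
  then show ?case
    using Suc.IH[of e' "pderiv q"] Suc.prems e by (simp add: funpow_Suc_right del: funpow.simps)
qed

text \<open>Integrating \<open>(p\<^sup>(\<^sup>m\<^sup>))\<^sup>2\<close> by parts \<open>m\<close> times, with \<open>p\<^sup>(\<^sup>2\<^sup>m\<^sup>) = 0\<close>, leaves
  these boundary terms.\<close>

definition energy :: "nat \<Rightarrow> real poly \<Rightarrow> real poly" where
  "energy m p = (\<Sum>k<m. (-1) ^ k * (pderiv ^^ (m + k)) p * (pderiv ^^ (m - 1 - k)) p)"

lemma higher_pderiv_diff: "(pderiv ^^ j) (p - q) = (pderiv ^^ j) p - (pderiv ^^ j) (q :: real poly)"
  by (induction j) (simp_all add: pderiv_diff)

text \<open>The alternating signs make the product rule telescope. The first term is the square, and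
  the last contains the derivative of order \<open>2 * m\<close>, which is zero by the degree
  bound.\<close>

lemma pderiv_energy:
  assumes "degree p < 2 * m"
  shows "pderiv (energy m p) = ((pderiv ^^ m) p)\<^sup>2"
proof -
  let ?f = "\<lambda>k. (-1) ^ k * (pderiv ^^ (m + k)) p * (pderiv ^^ (m - k)) p"
  have c: "pderiv ((-1) ^ k :: real poly) = 0" for k
    by (cases "even k") (simp_all add: pderiv_minus)
  have "pderiv (energy m p) = (\<Sum>k<m. ?f k - ?f (Suc k))"
    unfolding energy_def higher_pderiv_sum[of 1, simplified]
  proof (rule sum.cong[OF refl])
    fix k assume "k \<in> {..<m}"
    then have "m - k = Suc (m - 1 - k)" by simp
    then have "(pderiv ^^ (m - k)) p = pderiv ((pderiv ^^ (m - 1 - k)) p)" by simp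
    then show "pderiv ((-1) ^ k * (pderiv ^^ (m + k)) p * (pderiv ^^ (m - 1 - k)) p)
        = ?f k - ?f (Suc k)"
      by (simp add: pderiv_mult c algebra_simps)
  qed
  also have "\<dots> = ?f 0 - ?f m" by (rule sum_lessThan_telescope')
  also have "?f m = 0" using assms by (simp add: higher_pderiv_eq_0_degree mult_2)
  finally show ?thesis by (simp add: power2_eq_square)
qed

text \<open>The energies of the pieces glue to a continuous function that is nondecreasing and
  vanishes at both ends. So it is constant, every piece has vanishing derivative of order
  \<open>m\<close>, and the zeros at the left end spread from piece to piece.\<close>

lemma spline_eq_0_of_hermite_zeros:
  fixes T :: "nat \<Rightarrow> real" and p :: "nat \<Rightarrow> real poly" and \<mu> :: "nat \<Rightarrow> nat"
  assumes T: "\<And>j. j \<le> r \<Longrightarrow> T j < T (Suc j)"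
    and deg: "\<And>j. j \<le> r \<Longrightarrow> degree (p j) < 2 * m"
    and left: "\<And>s. s < m \<Longrightarrow> poly ((pderiv ^^ s) (p 0)) (T 0) = 0"
    and right: "\<And>s. s < m \<Longrightarrow> poly ((pderiv ^^ s) (p r)) (T (Suc r)) = 0"
    and mult: "\<And>j. j < r \<Longrightarrow> \<mu> (Suc j) \<le> m"
    and zero: "\<And>j s. j < r \<Longrightarrow> s < \<mu> (Suc j) \<Longrightarrow> poly ((pderiv ^^ s) (p j)) (T (Suc j)) = 0"
    and jump: "\<And>j. j < r \<Longrightarrow> [:-T (Suc j), 1:] ^ (2 * m - \<mu> (Suc j)) dvd p (Suc j) - p j"
    and "j \<le> r"
  shows "p j = 0"
proof -
  let ?W = "\<lambda>j. energy m (p j)"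
  have dW: "pderiv (?W j) = ((pderiv ^^ m) (p j))\<^sup>2" if "j \<le> r" for j
    using pderiv_energy deg that by blast
  have smooth: "poly ((pderiv ^^ s) (p (Suc j))) (T (Suc j)) = poly ((pderiv ^^ s) (p j)) (T (Suc j))"
    if "j < r" "s < 2 * m - \<mu> (Suc j)" for j s
    using linear_power_dvd_imp_pderiv_funpow[OF jump[OF that(1)] that(2)]
    by (simp add: higher_pderiv_diff)
  have glue: "poly (?W (Suc j)) (T (Suc j)) = poly (?W j) (T (Suc j))" if j: "j < r" for j
    unfolding energy_def poly_sum
  proof (rule sum.cong[OF refl])
    fix k assume k: "k \<in> {..<m}"
    let ?t = "T (Suc j)"
    show "poly ((-1) ^ k * (pderiv ^^ (m + k)) (p (Suc j)) * (pderiv ^^ (m - 1 - k)) (p (Suc j))) ?t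
        = poly ((-1) ^ k * (pderiv ^^ (m + k)) (p j) * (pderiv ^^ (m - 1 - k)) (p j)) ?t"
    \<comment> \<open>Either the factor of low order vanishes on both sides of the knot, or
      \<open>\<mu> (Suc j) \<le> m - 1 - k\<close> and both factors are continuous there.\<close>
    proof (cases "m - 1 - k < \<mu> (Suc j)")
      case True
      then show ?thesis
        using zero[OF j True] smooth[OF j, of "m - 1 - k"] mult[OF j] k by auto
    next
      case False
      then have "m + k < 2 * m - \<mu> (Suc j)" "m - 1 - k < 2 * m - \<mu> (Suc j)" using k by auto
      then show ?thesis using smooth[OF j] by simp
    qed
  qed
  have W0: "poly (?W 0) (T 0) = 0" using left by (simp add: energy_def poly_sum)
  have Wr: "poly (?W r) (T (Suc r)) = 0" using right by (simp add: energy_def poly_sum)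
  have mono: "poly (?W j) (T j) \<le> poly (?W j) (T (Suc j))" if "j \<le> r" for j
    using poly_mono_of_pderiv_square[OF dW[OF that]] T[OF that] by simp
  have lower: "j \<le> r \<Longrightarrow> 0 \<le> poly (?W j) (T j)" for j
  proof (induction j)
    case (Suc j)
    then show ?case using glue[of j] mono[of j] by simp
  qed (simp add: W0)
  have upper: "poly (?W j) (T (Suc j)) \<le> 0" if "j \<le> r" for j
    using that
  proof (induction j rule: inc_induct)
    case (step j)
    then show ?case using glue[of j] mono[of "Suc j"] by simp
  qed (simp add: Wr)
  \<comment> \<open>The bounds from the left (\<open>lower\<close>) and from the right
    (\<open>upper\<close>) pinch the nondecreasing energy of each piece to zero at both its
    ends.\<close>
  have high: "(pderiv ^^ m) (p j) = 0" if "j \<le> r" for j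
  proof (rule pderiv_square_eq_0[OF dW[OF that] T[OF that]])
    show "poly (?W j) (T j) = poly (?W j) (T (Suc j))"
      using mono lower upper that by (meson order_antisym order_trans)
  qed
  from \<open>j \<le> r\<close> show ?thesis
  proof (induction j)
    case 0
    then show ?case using pderiv_funpow_eq_0_imp_eq_0[of m "p 0" "T 0"] high left by simp
  next
    case (Suc j)
    then have "p j = 0" "j < r" by auto
    \<comment> \<open>With \<open>p j = 0\<close> the jump is \<open>p (Suc j)\<close> itself, so
      this piece has a zero of order \<open>2 * m - \<mu> (Suc j)\<close>, which is at least
      \<open>m\<close>.\<close>
    then have "poly ((pderiv ^^ s) (p (Suc j))) (T (Suc j)) = 0" if "s < m" for s
      using linear_power_dvd_imp_pderiv_funpow[OF jump[of j], of s] mult[of j] that by simp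
    then show ?case using pderiv_funpow_eq_0_imp_eq_0 high Suc by blast
  qed
qed

text \<open>Translation by \<open>t\<close> turns the powers into monomials, whose exponents are
  distinct by injectivity of \<open>e\<close>.\<close>

lemma linear_power_combination_eq_0:
  fixes c :: "'i \<Rightarrow> real"
  assumes "finite I" "inj_on e I" "(\<Sum>i\<in>I. Polynomial.smult (c i) ([:-t, 1:] ^ e i)) = 0" "i \<in> I"
  shows "c i = 0"
proof -
  let ?q = "\<Sum>i\<in>I. Polynomial.monom (c i) (e i)"
  have "poly ?q y = 0" for y
    using arg_cong[OF assms(3), of "\<lambda>p. poly p (t + y)"]
    by (simp add: poly_sum poly_monom)
  then have "?q = 0" by (simp only: poly_all_0_iff_0[symmetric]) blast
  then have "0 = Polynomial.coeff ?q (e i)" by simp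
  also have "\<dots> = (\<Sum>k\<in>I. if k = i then c k else 0)"
    unfolding coeff_sum by (rule sum.cong) (use assms in \<open>auto simp: inj_on_eq_iff\<close>)
  finally show ?thesis using assms by simp
qed

subsection \<open>Derivatives of B-splines\<close>

text \<open>The critical point is 0, where for \<open>p = 1\<close> there is a kink; from
  \<open>p = 2\<close> on the difference quotient is bounded by |h|^(p-1), which tends to 0.\<close>

lemma trunc_pow_has_real_derivative:
  assumes "2 \<le> p"
  shows "(trunc_pow p has_real_derivative real p * trunc_pow (p - 1) y) (at y)"
proof -
  consider "y < 0" | "y > 0" | "y = 0" by linarith
  then show ?thesis
  proof cases
    case 1
    have "((\<lambda>_. 0) has_real_derivative 0) (at y)" by simp
    then have "(trunc_pow p has_real_derivative 0) (at y)"
      by (rule has_field_derivative_transform_within_open[of _ _ _ "{..<0}"])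
         (use 1 in \<open>auto simp: trunc_pow_def\<close>)
    then show ?thesis using 1 by (simp add: trunc_pow_def)
  next
    case 2
    have "((\<lambda>y. y ^ p) has_real_derivative real p * y ^ (p - 1)) (at y)"
      by (auto intro!: derivative_eq_intros)
    then have "(trunc_pow p has_real_derivative real p * y ^ (p - 1)) (at y)"
      by (rule has_field_derivative_transform_within_open[of _ _ _ "{0<..}"])
         (use 2 in \<open>auto simp: trunc_pow_def\<close>)
    then show ?thesis using 2 by (simp add: trunc_pow_def)
  next
    case 3
    have "((\<lambda>h. trunc_pow p h / h) \<longlongrightarrow> 0) (at 0)"
    proof (rule Lim_null_comparison)
      show "\<forall>\<^sub>F h in at 0. norm (trunc_pow p h / h) \<le> \<bar>h\<bar> ^ (p - 1)"
        using assms by (intro always_eventually) (auto simp: trunc_pow_def power_diff)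
      have "((\<lambda>h. \<bar>h\<bar> ^ (p - 1)) \<longlongrightarrow> \<bar>0\<bar> ^ (p - 1)) (at (0::real))"
        by (intro tendsto_intros)
      moreover have "\<bar>0 :: real\<bar> ^ (p - 1) = 0" using assms by simp
      ultimately show "((\<lambda>h. \<bar>h\<bar> ^ (p - 1)) \<longlongrightarrow> 0) (at (0::real))" by (simp only:)
    qed
    then show ?thesis unfolding 3 by (simp add: DERIV_def trunc_pow_def)
  qed
qed

text \<open>A block of \<open>j' + 1\<close> equal nodes contributes a truncated power of exponent
  \<open>p - j'\<close>. The assumption on blocks keeps this exponent at least 2, so that it is
  differentiable in \<open>x\<close> everywhere.\<close>

lemma divdiff_trunc_pow_has_real_derivative:
  assumes "2 \<le> p"
    and "\<And>k' j'. k \<le> k' \<Longrightarrow> k' + j' \<le> k + j \<Longrightarrow> \<theta> (k' + j') = \<theta> k' \<Longrightarrow> j' + 2 \<le> p"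
  shows "((\<lambda>x. divdiff \<theta> (\<lambda>t. trunc_pow p (t - x)) k j) has_real_derivative
    - real p * divdiff \<theta> (\<lambda>t. trunc_pow (p - 1) (t - x)) k j) (at x)"
  using assms(2)
proof (induction j arbitrary: k)
  have trunc: "((\<lambda>x. trunc_pow q (t - x)) has_real_derivative - (real q * trunc_pow (q - 1) (t - x))) (at x)"
    if "2 \<le> q" for q t
  proof -
    have "((\<lambda>x. t - x) has_real_derivative - 1) (at x)"
      by (auto intro!: derivative_eq_intros)
    from DERIV_chain2[where g = "\<lambda>x. t - x", OF trunc_pow_has_real_derivative[OF that] this]
    show ?thesis by simp
  qed
  {
    case 0
    show ?case using trunc[OF assms(1), of "\<theta> k"] by simp
  next
    case (Suc j)
    show ?case
    proof (cases "\<theta> (k + Suc j) = \<theta> k")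
      case True
      have le: "Suc j + 2 \<le> p" using Suc.prems[of k "Suc j"] True by simp
      then have le1: "Suc j \<le> p" and le2: "Suc j \<le> p - 1" by auto
      have f: "fact p = real p * fact (p - 1)" "fact (p - Suc j) = real (p - Suc j) * fact (p - 1 - Suc j)"
        using le by (auto simp: fact_reduce diff_commute)
      have "((\<lambda>x. fact p / fact (p - Suc j) * trunc_pow (p - Suc j) (\<theta> k - x) / fact (Suc j))
          has_real_derivative fact p / fact (p - Suc j)
            * - (real (p - Suc j) * trunc_pow (p - Suc j - 1) (\<theta> k - x)) / fact (Suc j)) (at x)"
        by (intro DERIV_cdivide DERIV_cmult trunc) (use le in auto)
      moreover have "fact p / fact (p - Suc j)
            * - (real (p - Suc j) * trunc_pow (p - Suc j - 1) (\<theta> k - x)) / fact (Suc j)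
          = - real p * (fact (p - 1) / fact (p - 1 - Suc j) * trunc_pow (p - 1 - Suc j) (\<theta> k - x) / fact (Suc j))"
        using le unfolding f by (simp add: diff_commute)
      ultimately show ?thesis
        by (simp only: divdiff_confluent[OF True] left_deriv_funpow_trunc_pow[OF le1]
            left_deriv_funpow_trunc_pow[OF le2])
    next
      case False
      have "((\<lambda>x. (divdiff \<theta> (\<lambda>t. trunc_pow p (t - x)) (Suc k) j
              - divdiff \<theta> (\<lambda>t. trunc_pow p (t - x)) k j) / (\<theta> (k + Suc j) - \<theta> k)) has_real_derivative
          (- real p * divdiff \<theta> (\<lambda>t. trunc_pow (p - 1) (t - x)) (Suc k) j
              - (- real p * divdiff \<theta> (\<lambda>t. trunc_pow (p - 1) (t - x)) k j)) / (\<theta> (k + Suc j) - \<theta> k)) (at x)"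
        by (intro DERIV_cdivide DERIV_diff Suc.IH; rule Suc.prems; (assumption | simp))
      then show ?thesis
        using False by (simp add: right_diff_distrib minus_divide_left)
    qed
  }
qed

text \<open>Each derivative in \<open>x\<close> lowers the exponent by one and contributes minus the
  old exponent. The point stays below \<open>b\<close>, where the spline is given by the divided
  difference and not by a limit.\<close>

lemma higher_deriv_bspline:
  assumes "\<And>k' j'. k \<le> k' \<Longrightarrow> k' + j' \<le> k + d \<Longrightarrow> \<theta> (k' + j') = \<theta> k' \<Longrightarrow> j' + \<nu> + 2 \<le> d"
    and "x < b"
  shows "(deriv ^^ \<nu>) (bspline b \<theta> d k) x = (-1) ^ \<nu> * (fact (d - 1) / fact (d - 1 - \<nu>)) *
    ((\<theta> (k + d) - \<theta> k) * divdiff \<theta> (\<lambda>t. trunc_pow (d - 1 - \<nu>) (t - x)) k d)"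
  using assms
proof (induction \<nu> arbitrary: x)
  case 0
  then show ?case by (simp add: bspline_def bspline_raw_def)
next
  case (Suc \<nu>)
  define C where "C = (-1) ^ \<nu> * (fact (d - 1) / fact (d - 1 - \<nu>)) * (\<theta> (k + d) - \<theta> k)"
  have d: "\<nu> + 3 \<le> d" using Suc.prems(1)[of k 0] by simp
  have run: "j' + \<nu> + 2 \<le> d" if "k \<le> k'" "k' + j' \<le> k + d" "\<theta> (k' + j') = \<theta> k'" for k' j'
    using Suc.prems(1)[OF that] by simp
  have IH: "(deriv ^^ \<nu>) (bspline b \<theta> d k) y = C * divdiff \<theta> (\<lambda>t. trunc_pow (d - 1 - \<nu>) (t - y)) k d"
    if "y < b" for y
    using Suc.IH[OF run that] by (simp only: C_def mult.assoc)
  have "((\<lambda>y. C * divdiff \<theta> (\<lambda>t. trunc_pow (d - 1 - \<nu>) (t - y)) k d) has_real_derivative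
      C * (- real (d - 1 - \<nu>) * divdiff \<theta> (\<lambda>t. trunc_pow (d - 1 - \<nu> - 1) (t - x)) k d)) (at x)"
  proof (intro DERIV_cmult divdiff_trunc_pow_has_real_derivative)
    show "2 \<le> d - 1 - \<nu>" using d by simp
    show "j' + 2 \<le> d - 1 - \<nu>" if "k \<le> k'" "k' + j' \<le> k + d" "\<theta> (k' + j') = \<theta> k'" for k' j'
      using Suc.prems(1)[OF that] by simp
  qed
  then have "((deriv ^^ \<nu>) (bspline b \<theta> d k) has_real_derivative
      C * (- real (d - 1 - \<nu>) * divdiff \<theta> (\<lambda>t. trunc_pow (d - 1 - \<nu> - 1) (t - x)) k d)) (at x)"
    \<comment> \<open>The formula of order \<open>\<nu>\<close> holds on an open set around
      \<open>x\<close>, so it may be differentiated.\<close>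
    by (rule has_field_derivative_transform_within_open[of _ _ _ "{..<b}"])
       (use Suc.prems IH in auto)
  then have "(deriv ^^ Suc \<nu>) (bspline b \<theta> d k) x
      = C * (- real (d - 1 - \<nu>) * divdiff \<theta> (\<lambda>t. trunc_pow (d - 1 - Suc \<nu>) (t - x)) k d)"
    using DERIV_imp_deriv by simp
  moreover have "C * - real (d - 1 - \<nu>)
      = (-1) ^ Suc \<nu> * (fact (d - 1) / fact (d - 1 - Suc \<nu>)) * (\<theta> (k + d) - \<theta> k)"
  proof -
    define r where "r = real (d - 1 - \<nu>)"
    have e: "d - 1 - \<nu> = Suc (d - 1 - Suc \<nu>)" using d by simp
    have "fact (d - 1 - \<nu>) = r * fact (d - 1 - Suc \<nu>)"
      unfolding r_def unfolding e fact_Suc by simp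
    moreover have "r \<noteq> 0" using d by (simp add: r_def)
    ultimately have "fact (d - 1 - \<nu>) = r * fact (d - 1 - Suc \<nu>)" "r \<noteq> 0" by blast+
    then show ?thesis unfolding C_def r_def[symmetric] by simp
  qed
  ultimately show ?case by (simp only: mult.assoc[symmetric])
qed

subsection \<open>Linear independence of the rows\<close>

lemma open_knot_vectorD:
  assumes "open_knot_vector m n a b \<theta>"
  shows "1 \<le> m" "a < b" "mono_on {1..n + m} \<theta>" "m \<le> n"
    and "\<And>k. 1 \<le> k \<Longrightarrow> k \<le> m \<Longrightarrow> \<theta> k = a"
    and "\<And>k. n + 1 \<le> k \<Longrightarrow> k \<le> n + m \<Longrightarrow> \<theta> k = b"
    and "\<And>k. m + 1 \<le> k \<Longrightarrow> k \<le> n \<Longrightarrow> a < \<theta> k \<and> \<theta> k < b \<and> knot_mult m n \<theta> (\<theta> k) \<le> m - 1"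
proof -
  show 1: "1 \<le> m" "a < b" "mono_on {1..n + m} \<theta>"
    using assms unfolding open_knot_vector_def by blast+
  show 2: "\<theta> k = a" if "1 \<le> k" "k \<le> m" for k
    using assms that unfolding open_knot_vector_def by (meson atLeastAtMost_iff)
  show 3: "\<theta> k = b" if "n + 1 \<le> k" "k \<le> n + m" for k
    using assms that unfolding open_knot_vector_def by (meson atLeastAtMost_iff)
  show "a < \<theta> k \<and> \<theta> k < b \<and> knot_mult m n \<theta> (\<theta> k) \<le> m - 1" if "m + 1 \<le> k" "k \<le> n" for k
    using assms that unfolding open_knot_vector_def by (meson atLeastAtMost_iff)
  \<comment> \<open>For \<open>n < m\<close> the knot with index \<open>m\<close> would lie in both
    end blocks and equal both \<open>a\<close> and \<open>b\<close>.\<close>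
  show "m \<le> n"
  proof (rule ccontr)
    assume "\<not> m \<le> n"
    then show False using 1 2[of m] 3[of m] by simp
  qed
qed

lemma selected_knotsD:
  assumes "selected_knots m n \<theta> r l \<mu>"
  shows "strict_mono_on {1..r} l"
    and "\<And>j. 1 \<le> j \<Longrightarrow> j \<le> r \<Longrightarrow> m + 1 \<le> l j \<and> l j \<le> n \<and> \<theta> (l j - 1) < \<theta> (l j) \<and>
      \<mu> j \<le> knot_mult m n \<theta> (\<theta> (l j))"
  using assms unfolding selected_knots_def by (blast, meson atLeastAtMost_iff)

text \<open>No value occurs more than \<open>m\<close> times in a row: the end blocks have
  \<open>m\<close> knots each, and interior multiplicities are at most \<open>m - 1\<close>.\<close>

lemma open_knot_vector_run:
  assumes "open_knot_vector m n a b \<theta>" "1 \<le> k" "k + j \<le> n + m" "\<theta> (k + j) = \<theta> k"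
  shows "j + 1 \<le> m"
proof -
  note okv = open_knot_vectorD[OF assms(1)]
  note mono = okv(3)
  have run: "\<theta> i = \<theta> k" if "k \<le> i" "i \<le> k + j" for i
  proof -
    have "\<theta> k \<le> \<theta> i" "\<theta> i \<le> \<theta> (k + j)"
      by (rule mono_onD[OF mono]; use assms that in simp)+
    then show ?thesis using assms(4) by simp
  qed
  consider "k \<le> m" | "m + 1 \<le> k" "k \<le> n" | "m + 1 \<le> k" "n + 1 \<le> k" by linarith
  then show ?thesis
  proof cases
    case 1
    have a: "\<theta> (k + j) = a" using assms 1 okv(5)[of k] by simp
    have "k + j \<le> m"
    proof (rule ccontr)
      assume "\<not> k + j \<le> m"
      then show False
        using a okv(2) okv(6)[of "k + j"] okv(7)[of "k + j"] assms(3) by (cases "k + j \<le> n") auto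
    qed
    then show ?thesis using assms(2) by simp
  next
    case 2
    have "{k..k + j} \<subseteq> {i \<in> {1..n + m}. \<theta> i = \<theta> k}" 
      using assms(2,3) by (auto intro!: run)
    from card_mono[OF _ this] have "j + 1 \<le> knot_mult m n \<theta> (\<theta> k)"
      unfolding knot_mult_def by simp
    then show ?thesis using okv(1) okv(7)[OF 2] by auto
  next
    case 3
    then show ?thesis using assms by simp
  qed
qed

lemma knot_run:
  assumes "mono_on {1..n + m} \<theta>" "1 \<le> l" "l \<le> n + m" "\<nu> < knot_mult m n \<theta> (\<theta> l)"
    and first: "l = 1 \<or> \<theta> (l - 1) < \<theta> l"
  shows "l + \<nu> \<le> n + m" "\<theta> (l + \<nu>) = \<theta> l"
proof -
  let ?I = "{i \<in> {1..n + m}. \<theta> i = \<theta> l}"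
  \<comment> \<open>Pigeonhole: \<open>l\<close> is the first occurrence, so otherwise all
    occurrences would lie among the \<open>\<nu>\<close> indices from \<open>l\<close> to
    \<open>l + \<nu> - 1\<close>.\<close>
  have "\<exists>i\<in>?I. l + \<nu> \<le> i"
  proof (rule ccontr)
    assume neg: "\<not> (\<exists>i\<in>?I. l + \<nu> \<le> i)"
    have "?I \<subseteq> {l..<l + \<nu>}"
    proof
      fix i assume i: "i \<in> ?I"
      have "l \<le> i"
      proof (rule ccontr)
        assume "\<not> l \<le> i"
        then have "i \<le> l - 1" "l \<noteq> 1" using i by auto
        then have "\<theta> i \<le> \<theta> (l - 1)" using i \<open>l \<le> n + m\<close>
          by (intro mono_onD[OF assms(1)]) auto
        then show False using first \<open>l \<noteq> 1\<close> i by auto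
      qed
      then show "i \<in> {l..<l + \<nu>}" using neg i by force
    qed
    from card_mono[OF _ this] have "knot_mult m n \<theta> (\<theta> l) \<le> \<nu>" unfolding knot_mult_def by simp
    then show False using assms(4) by simp
  qed
  then obtain i where i: "i \<in> {1..n + m}" "\<theta> i = \<theta> l" "l + \<nu> \<le> i" by auto
  then show le: "l + \<nu> \<le> n + m" by simp
  have "\<theta> l \<le> \<theta> (l + \<nu>)" "\<theta> (l + \<nu>) \<le> \<theta> i"
    by (rule mono_onD[OF assms(1)]; use i assms(2) le in simp)+
  then show "\<theta> (l + \<nu>) = \<theta> l" using i by simp
qed

text \<open>The index set is abstract, with \<open>\<kappa>\<close> naming the knot and
  \<open>\<nu>\<close> the drop in exponent, so that row numbers of the matrix can serve as indices;
  \<open>inj\<close> says that no truncated power occurs twice.\<close>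

lemma truncated_powers_divdiff_independent:
  fixes c :: "'i \<Rightarrow> real" and \<kappa> \<nu> :: "'i \<Rightarrow> nat"
  assumes okv: "open_knot_vector m n a b \<theta>" and sel: "selected_knots m n \<theta> r l \<mu>"
    and fin: "finite I" and \<kappa>: "\<And>i. i \<in> I \<Longrightarrow> 1 \<le> \<kappa> i \<and> \<kappa> i \<le> r"
    and \<nu>: "\<And>i. i \<in> I \<Longrightarrow> \<nu> i < \<mu> (\<kappa> i)"
    and inj: "inj_on (\<lambda>i. (\<kappa> i, \<nu> i)) I"
    and zero: "\<And>k. 1 \<le> k \<Longrightarrow> k + 2 * m \<le> n + m \<Longrightarrow>
      divdiff \<theta> (\<lambda>t. \<Sum>i\<in>I. c i * trunc_pow (2 * m - 1 - \<nu> i) (t - \<theta> (l (\<kappa> i)))) k (2 * m) = 0"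
    and "i \<in> I"
  shows "c i = 0"
proof -
  let ?G = "\<lambda>t. \<Sum>i\<in>I. c i * trunc_pow (2 * m - 1 - \<nu> i) (t - \<theta> (l (\<kappa> i)))"
  note okv' = open_knot_vectorD[OF okv]
  note m = okv'(1) and ab = okv'(2) and mono = okv'(3) and mn = okv'(4) and first = okv'(5) and last = okv'(6)
  define \<tau> where "\<tau> j = \<theta> (l j)" for j
  have l: "m + 1 \<le> l j" "l j \<le> n" "\<theta> (l j - 1) < \<tau> j" "\<mu> j \<le> knot_mult m n \<theta> (\<tau> j)"
    if "1 \<le> j" "j \<le> r" for j
    using selected_knotsD(2)[OF sel that] by (auto simp: \<tau>_def)
  have \<tau>: "a < \<tau> j" "\<tau> j < b" "\<mu> j \<le> m - 1" if "1 \<le> j" "j \<le> r" for j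
    using l[OF that] okv'(7)[of "l j"] by (auto simp: \<tau>_def)
  have \<tau>_less: "\<tau> i < \<tau> j" if "1 \<le> i" "i < j" "j \<le> r" for i j
  proof -
    have "l i < l j" using strict_mono_onD[OF selected_knotsD(1)[OF sel], of i j] that by simp
    then have "\<theta> (l i) \<le> \<theta> (l j - 1)"
      using l[of i] l[of j] that by (intro mono_onD[OF mono]) auto
    then show ?thesis using l(3)[of j] that by (simp add: \<tau>_def)
  qed

  \<comment> \<open>Interpolation at the first \<open>2 * m\<close> knots is enough, since the
    vanishing differences of order \<open>2 * m\<close> carry it to all others. These knots exist
    because \<open>m \<le> n\<close>.\<close>
  obtain P where P: "degree P \<le> 2 * m - 1"
      "\<And>i. i \<le> 2 * m - 1 \<Longrightarrow> divdiff \<theta> (poly P) 1 i = divdiff \<theta> ?G 1 i"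
    using newton_interpolation[OF mono, of 1 "2 * m - 1" "divdiff \<theta> ?G 1"] m mn by auto
  define H where "H = (\<lambda>t. -1 * poly P t + ?G t)"
  have G: "left_poly ?G"
    by (rule left_poly_sum[OF fin]) (rule left_poly_trunc_pow)
  have divdiff_H: "divdiff \<theta> H k j = divdiff \<theta> ?G k j - divdiff \<theta> (poly P) k j" for k j
    unfolding H_def by (subst divdiff_linear[OF left_poly_poly G]) simp
  have H_zero: "divdiff \<theta> H k j = 0" if "j \<le> 2 * m" "1 \<le> k" "k + j \<le> n + m" for k j
  proof (rule divdiff_zero_propagate[OF mono _ _ that])
    show "divdiff \<theta> H 1 j = 0" if "j < 2 * m" for j
      using that P(2)[of j] by (simp only: divdiff_H)
    show "divdiff \<theta> H k (2 * m) = 0" if "1 \<le> k" "k + 2 * m \<le> n + m" for k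
      using divdiff_poly_zero[OF mono that, of P] P(1) m zero[OF that] by (simp only: divdiff_H)
  qed
  have hermite: "(left_deriv ^^ s) H (\<theta> k) = 0"
    if "1 \<le> k" "k + s \<le> n + m" "\<theta> (k + s) = \<theta> k" "s \<le> 2 * m" for k s
    using H_zero[of s k] that divdiff_confluent[of \<theta> k s H] by simp

  define q where "q i = Polynomial.smult (c i) ([:-\<tau> (\<kappa> i), 1:] ^ (2 * m - 1 - \<nu> i))" for i
  \<comment> \<open>The polynomial piece of \<open>H\<close> after the \<open>j\<close>-th selected
    knot: exactly the powers whose knots have been passed are active.\<close>
  define p where "p j = (\<Sum>i\<in>{i \<in> I. \<kappa> i \<le> j}. q i) - P" for j
  have H_eq: "H s = poly (p j) s"
    if "\<And>i. 1 \<le> i \<Longrightarrow> i \<le> j \<Longrightarrow> \<tau> i < s" "\<And>i. j < i \<Longrightarrow> i \<le> r \<Longrightarrow> s \<le> \<tau> i" for s j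
  proof -
    have "?G s = (\<Sum>i\<in>I. if \<kappa> i \<le> j then poly (q i) s else 0)"
    proof (rule sum.cong[OF refl])
      fix i assume "i \<in> I"
      then show "c i * trunc_pow (2 * m - 1 - \<nu> i) (s - \<theta> (l (\<kappa> i)))
          = (if \<kappa> i \<le> j then poly (q i) s else 0)"
        using that[of "\<kappa> i"] \<kappa>[of i] by (auto simp: trunc_pow_def q_def \<tau>_def)
    qed
    also have "\<dots> = (\<Sum>i\<in>{i \<in> I. \<kappa> i \<le> j}. poly (q i) s)"
      by (rule sum.inter_filter[OF fin, symmetric])
    finally show ?thesis by (simp add: H_def p_def poly_sum)
  qed
  \<comment> \<open>The break points are the end points and the selected knots only:
    \<open>H\<close> is a single polynomial between consecutive ones.\<close>
  define T where "T j = (if j = 0 then a else if j \<le> r then \<tau> j else b)" for j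
  have T_less: "T j < T (Suc j)" if "j \<le> r" for j
    using that ab \<tau> \<tau>_less[of j "Suc j"] by (auto simp: T_def)
  \<comment> \<open>Left derivatives at a break point see the piece to its left, because a truncated
    power is still zero at its own knot.\<close>
  have p_at: "poly ((pderiv ^^ s) (p j)) (T (Suc j)) = (left_deriv ^^ s) H (T (Suc j))" if "j \<le> r" for j s
  proof (rule left_deriv_funpow_eq_poly[OF T_less[OF that], symmetric])
    fix x assume x: "x \<in> {T j<..T (Suc j)}"
    show "H x = poly (p j) x"
    proof (rule H_eq)
      fix i assume i: "1 \<le> i" "i \<le> j"
      then have "\<tau> i \<le> T j" using \<tau>_less[of i j] that by (cases "i = j") (auto simp: T_def)
      then show "\<tau> i < x" using x by simp
    next
      fix i assume i: "j < i" "i \<le> r"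
      then have "T (Suc j) \<le> \<tau> i" using \<tau>_less[of "Suc j" i] by (cases "i = Suc j") (auto simp: T_def)
      then show "x \<le> \<tau> i" using x by simp
    qed
  qed
  \<comment> \<open>The point \<open>a\<close> is the left end of the first piece, but no power is
    active before it, so \<open>H\<close> equals \<open>p 0\<close> to the left of \<open>a\<close>
    as well.\<close>
  have p_a: "poly ((pderiv ^^ s) (p 0)) a = (left_deriv ^^ s) H a" for s
  proof (rule left_deriv_funpow_eq_poly[of "a - 1", symmetric])
    show "H x = poly (p 0) x" if "x \<in> {a - 1<..a}" for x
    proof (rule H_eq)
      show "x \<le> \<tau> i" if "0 < i" "i \<le> r" for i
        using \<tau>(1)[of i] that \<open>x \<in> {a - 1<..a}\<close> by simp
    qed simp
  qed simp
  have p_Suc: "p (Suc j) - p j = (\<Sum>i\<in>{i \<in> I. \<kappa> i = Suc j}. q i)" for j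
  proof -
    have "{i \<in> I. \<kappa> i \<le> Suc j} = {i \<in> I. \<kappa> i \<le> j} \<union> {i \<in> I. \<kappa> i = Suc j}" by auto
    moreover have "(\<Sum>i\<in>{i \<in> I. \<kappa> i \<le> j} \<union> {i \<in> I. \<kappa> i = Suc j}. q i)
        = (\<Sum>i\<in>{i \<in> I. \<kappa> i \<le> j}. q i) + (\<Sum>i\<in>{i \<in> I. \<kappa> i = Suc j}. q i)"
      by (rule sum.union_disjoint) (use fin in auto)
    ultimately show ?thesis by (simp add: p_def)
  qed
  have p_zero: "p j = 0" if "j \<le> r" for j
  proof (rule spline_eq_0_of_hermite_zeros[where T = T and p = p and \<mu> = \<mu>, OF T_less _ _ _ _ _ _ that])
    fix j assume "j \<le> r"
    have "degree (q i) \<le> 2 * m - 1" for i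
      unfolding q_def by (rule order_trans[OF degree_smult_le]) (simp add: degree_power_eq)
    then have "degree (p j) \<le> 2 * m - 1"
      unfolding p_def by (intro degree_diff_le degree_sum_le P(1)) (use fin in auto)
    then show "degree (p j) < 2 * m" using m by simp
  next
    fix s assume s: "s < m"
    show "poly ((pderiv ^^ s) (p 0)) (T 0) = 0"
      using p_a[of s] hermite[of 1 s] first[of 1] first[of "1 + s"] s m by (simp add: T_def)
    show "poly ((pderiv ^^ s) (p r)) (T (Suc r)) = 0"
      using p_at[of r s] hermite[of "n + 1" s] last[of "n + 1"] last[of "n + 1 + s"] s m
      by (simp add: T_def)
  next
    fix j assume j: "j < r"
    show "\<mu> (Suc j) \<le> m" using \<tau>(3)[of "Suc j"] j by simp
    show "poly ((pderiv ^^ s) (p j)) (T (Suc j)) = 0" if s: "s < \<mu> (Suc j)" for s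
    proof -
      have "l (Suc j) + s \<le> n + m" "\<theta> (l (Suc j) + s) = \<theta> (l (Suc j))"
        by (rule knot_run[OF mono]; use l[of "Suc j"] j s in \<open>simp add: \<tau>_def\<close>)+
      moreover have "s \<le> 2 * m" using s \<tau>(3)[of "Suc j"] j by simp
      ultimately show ?thesis
        using p_at[of j s] hermite[of "l (Suc j)" s] l(1)[of "Suc j"] j by (simp add: T_def \<tau>_def)
    qed
    show "[:-T (Suc j), 1:] ^ (2 * m - \<mu> (Suc j)) dvd p (Suc j) - p j"
      unfolding p_Suc
    proof (rule dvd_sum)
      fix i assume i: "i \<in> {i \<in> I. \<kappa> i = Suc j}"
      then have "2 * m - \<mu> (Suc j) \<le> 2 * m - 1 - \<nu> i" using \<nu>[of i] by auto
      moreover have "\<tau> (\<kappa> i) = T (Suc j)" using i j by (simp add: T_def)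
      ultimately show "[:-T (Suc j), 1:] ^ (2 * m - \<mu> (Suc j)) dvd q i"
        unfolding q_def by (metis dvd_smult le_imp_power_dvd)
    qed
  qed
  \<comment> \<open>The pieces on both sides of the knot belonging to \<open>i\<close> vanish, hence
    so does the jump, a combination of powers of one linear factor.\<close>
  obtain j where j: "\<kappa> i = Suc j" "j < r" using \<kappa>[OF \<open>i \<in> I\<close>] by (cases "\<kappa> i") auto
  show ?thesis
  proof (rule linear_power_combination_eq_0[where c = c and i = i])
    show "finite {i \<in> I. \<kappa> i = Suc j}" using fin by simp
    show "inj_on (\<lambda>i. 2 * m - 1 - \<nu> i) {i \<in> I. \<kappa> i = Suc j}"
    proof (rule inj_onI)
      fix i i' assume *: "i \<in> {i \<in> I. \<kappa> i = Suc j}" "i' \<in> {i \<in> I. \<kappa> i = Suc j}"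
        and eq: "2 * m - 1 - \<nu> i = 2 * m - 1 - \<nu> i'"
      \<comment> \<open>These bounds keep the natural subtraction in the exponents from
        truncating.\<close>
      have "\<nu> i < m" "\<nu> i' < m" using * \<nu>[of i] \<nu>[of i'] \<tau>(3)[of "Suc j"] j by auto
      then have "\<nu> i = \<nu> i'" using eq by simp
      then show "i = i'" using inj_onD[OF inj, of i i'] * by simp
    qed
    show "(\<Sum>i\<in>{i \<in> I. \<kappa> i = Suc j}.
        Polynomial.smult (c i) ([:-\<tau> (Suc j), 1:] ^ (2 * m - 1 - \<nu> i))) = 0"
      using p_Suc[of j] p_zero[of j] p_zero[of "Suc j"] j by (simp add: q_def)
    show "i \<in> {i \<in> I. \<kappa> i = Suc j}" using j \<open>i \<in> I\<close> by simp
  qed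
qed

subsection \<open>Full row rank\<close>

lemma scalar_prod_self_eq_0:
  fixes u :: "real Matrix.vec"
  assumes "u \<in> carrier_vec k" "u \<bullet> u = 0"
  shows "u = 0\<^sub>v k"
proof (rule eq_vecI)
  fix i assume "i < dim_vec (0\<^sub>v k :: real Matrix.vec)"
  moreover have "(\<Sum>i = 0..<k. u $ i * u $ i) = 0"
    using assms by (simp add: scalar_prod_def)
  ultimately show "u $ i = 0\<^sub>v k $ i"
    by (simp add: sum_nonneg_eq_0_iff)
qed (use assms in simp)

text \<open>The matrix \<open>A * A\<^sup>T\<close> is nonsingular, since a null vector
  \<open>v\<close> would make the squared norm of \<open>A\<^sup>T *\<^sub>v v\<close> zero. With
  its inverse \<open>N\<close>, \<open>A\<^sup>T * N\<close> is a right inverse of \<open>A\<close>,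
  so the columns span the whole space.\<close>

lemma rank_eq_dim_row:
  fixes A :: "real mat"
  assumes A: "A \<in> carrier_mat k nc"
    and inj: "\<And>v. v \<in> carrier_vec k \<Longrightarrow> A\<^sup>T *\<^sub>v v = 0\<^sub>v nc \<Longrightarrow> v = 0\<^sub>v k"
  shows "vec_space.rank k A = k"
proof -
  interpret vec_space "TYPE(real)" k .
  let ?M = "A * A\<^sup>T"
  have AT: "A\<^sup>T \<in> carrier_mat nc k" and M: "?M \<in> carrier_mat k k" using A by auto
  have "det ?M \<noteq> 0"
  proof
    assume "det ?M = 0"
    then obtain v where v: "v \<in> carrier_vec k" "v \<noteq> 0\<^sub>v k" "?M *\<^sub>v v = 0\<^sub>v k"
      using det_0_iff_vec_prod_zero[OF M] by auto
    have ATv: "A\<^sup>T *\<^sub>v v \<in> carrier_vec nc" using AT v by auto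
    have "(A\<^sup>T *\<^sub>v v) \<bullet> (A\<^sup>T *\<^sub>v v) = v \<bullet> (A *\<^sub>v (A\<^sup>T *\<^sub>v v))"
      using transpose_vec_mult_scalar[OF A ATv v(1)] .
    also have "A *\<^sub>v (A\<^sup>T *\<^sub>v v) = 0\<^sub>v k"
      using assoc_mult_mat_vec[OF A AT v(1)] v(3) by simp
    also have "v \<bullet> 0\<^sub>v k = 0" using v(1) by simp
    finally have "A\<^sup>T *\<^sub>v v = 0\<^sub>v nc"
      by (rule scalar_prod_self_eq_0[OF ATv])
    then show False using inj v by blast
  qed
  then obtain N where N: "N \<in> carrier_mat k k" "?M * N = 1\<^sub>m k"
    using det_non_zero_imp_unit[OF M, of "()"] by (auto simp: Units_def ring_mat_def)
  have "col_space A = carrier_vec k"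
  proof (rule equalityI)
    show "col_space A \<subseteq> carrier_vec k" using col_space_eq[OF A] A by auto
    show "carrier_vec k \<subseteq> col_space A"
    proof
      fix y :: "real Matrix.vec" assume y: "y \<in> carrier_vec k"
      have "A *\<^sub>v (A\<^sup>T *\<^sub>v (N *\<^sub>v y)) = ?M * N *\<^sub>v y"
        using assoc_mult_mat_vec[OF M N(1) y] assoc_mult_mat_vec[OF A AT, of "N *\<^sub>v y"] N y by simp
      then have "A *\<^sub>v (A\<^sup>T *\<^sub>v (N *\<^sub>v y)) = y" using N y by simp
      moreover have "A\<^sup>T *\<^sub>v (N *\<^sub>v y) \<in> carrier_vec nc" using AT N y by auto
      ultimately show "y \<in> col_space A" using col_space_eq[OF A] A y by auto
    qed
  qed
  then have "span_vs (set (cols A)) = V"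
    by (simp add: col_space_def)
  then show ?thesis using dim_is_n by (simp add: rank_def)
qed

section \<open>Application to the matrix of B-spline derivatives\<close>

lemma distinct_index_pairs: "distinct (index_pairs r \<mu>)"
proof -
  have "distinct [(j, \<nu>). j \<leftarrow> js, \<nu> \<leftarrow> [0..<\<mu> j]]" if "distinct js" for js
    using that by (induction js) (auto simp: distinct_map inj_on_def)
  then show ?thesis by (simp add: index_pairs_def del: upt_Suc)
qed

lemma index_pairs_nth:
  assumes "i < length (index_pairs r \<mu>)"
  shows "1 \<le> fst (index_pairs r \<mu> ! i)" "fst (index_pairs r \<mu> ! i) \<le> r"
    "snd (index_pairs r \<mu> ! i) < \<mu> (fst (index_pairs r \<mu> ! i))"
  using nth_mem[OF assms] by (auto simp: index_pairs_def simp del: upt_Suc)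

text \<open>Each entry is a divided difference of a truncated power, up to a nonzero weight
  depending on the row and a nonzero knot distance depending on the column. A null vector thus
  yields the hypothesis of \<open>truncated_powers_divdiff_independent\<close>.\<close>

lemma A_mat_transpose_injective:
  assumes okv: "open_knot_vector m n a b \<theta>" and sel: "selected_knots m n \<theta> r l \<mu>"
    and v: "v \<in> carrier_vec (\<Sum>j = 1..r. \<mu> j)"
    and eq: "(A_mat m n b \<theta> r l \<mu>)\<^sup>T *\<^sub>v v = 0\<^sub>v (n - m)"
  shows "v = 0\<^sub>v (\<Sum>j = 1..r. \<mu> j)"
proof -
  let ?rt = "\<Sum>j = 1..r. \<mu> j" and ?A = "A_mat m n b \<theta> r l \<mu>" and ?ps = "index_pairs r \<mu>"
  define \<kappa> where "\<kappa> i = fst (?ps ! i)" for i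
  define \<nu> where "\<nu> i = snd (?ps ! i)" for i
  have len: "length ?ps = ?rt" by (rule length_index_pairs)
  have \<kappa>: "1 \<le> \<kappa> i \<and> \<kappa> i \<le> r" and \<nu>: "\<nu> i < \<mu> (\<kappa> i)" if "i < ?rt" for i
    using index_pairs_nth[of i r \<mu>] that len by (auto simp: \<kappa>_def \<nu>_def)
  \<comment> \<open>The row weight: the factorial in the definition of \<open>A_mat\<close> times
    the constant from \<open>higher_deriv_bspline\<close>. It is absorbed into the
    coefficients.\<close>
  define w :: "nat \<Rightarrow> real" where "w i = fact (m - 1 - \<nu> i) * (-1) ^ \<nu> i * (fact (2 * m - 1) / fact (2 * m - 1 - \<nu> i))" for i
  have w: "w i \<noteq> 0" for i by (simp add: w_def)
  let ?f = "\<lambda>i t. trunc_pow (2 * m - 1 - \<nu> i) (t - \<theta> (l (\<kappa> i)))"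
  note m = open_knot_vectorD(1)[OF okv]
  have entry: "?A $$ (i, k) = w i * ((\<theta> (k + 1 + 2 * m) - \<theta> (k + 1)) * divdiff \<theta> (?f i) (k + 1) (2 * m))"
    if i: "i < ?rt" and k: "k < n - m" for i k
  proof -
    have sel': "m + 1 \<le> l (\<kappa> i)" "l (\<kappa> i) \<le> n" "\<mu> (\<kappa> i) \<le> knot_mult m n \<theta> (\<theta> (l (\<kappa> i)))"
      using selected_knotsD(2)[OF sel] \<kappa>[OF i] by auto
    then have lt: "\<theta> (l (\<kappa> i)) < b" and "knot_mult m n \<theta> (\<theta> (l (\<kappa> i))) \<le> m - 1"
      using open_knot_vectorD(7)[OF okv] by auto
    then have \<nu>m: "\<nu> i + 1 \<le> m" using \<nu>[OF i] sel' by simp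
    have "?A $$ (i, k) = fact (m - 1 - \<nu> i) * (deriv ^^ \<nu> i) (bspline b \<theta> (2 * m) (k + 1)) (\<theta> (l (\<kappa> i)))"
      using i k len by (simp add: A_mat_def mat_of_rows_def \<kappa>_def \<nu>_def split: prod.split)
    also have "(deriv ^^ \<nu> i) (bspline b \<theta> (2 * m) (k + 1)) (\<theta> (l (\<kappa> i)))
        = (-1) ^ \<nu> i * (fact (2 * m - 1) / fact (2 * m - 1 - \<nu> i)) *
          ((\<theta> (k + 1 + 2 * m) - \<theta> (k + 1)) * divdiff \<theta> (?f i) (k + 1) (2 * m))"
    proof (rule higher_deriv_bspline[OF _ lt])
      fix k' j' assume "k + 1 \<le> k'" "k' + j' \<le> k + 1 + 2 * m" "\<theta> (k' + j') = \<theta> k'"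
      then have "j' + 1 \<le> m" using open_knot_vector_run[OF okv, of k' j'] k by simp
      then show "j' + \<nu> i + 2 \<le> 2 * m" using \<nu>m by simp
    qed
    finally show ?thesis by (simp add: w_def)
  qed
  have zero: "divdiff \<theta> (\<lambda>t. \<Sum>i\<in>{..<?rt}. (w i * v $ i) * ?f i t) k (2 * m) = 0"
    if k: "1 \<le> k" "k + 2 * m \<le> n + m" for k
  proof -
    define k' where "k' = k - 1"
    have k': "k = k' + 1" "k' < n - m" using k m by (auto simp: k'_def)
    have "0 = (?A\<^sup>T *\<^sub>v v) $ k'" using eq k' by simp
    also have "\<dots> = (\<Sum>i<?rt. ?A $$ (i, k') * v $ i)"
      using A_mat_carrier[of m n b \<theta> r l \<mu>] v k'
      by (auto simp: scalar_prod_def atLeast0LessThan intro!: sum.cong)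
    also have "\<dots> = (\<Sum>i<?rt. (\<theta> (k + 2 * m) - \<theta> k) * ((w i * v $ i) * divdiff \<theta> (?f i) k (2 * m)))"
      by (rule sum.cong) (use k' entry in \<open>auto simp del: divdiff.simps\<close>)
    also have "\<dots> = (\<theta> (k + 2 * m) - \<theta> k) * divdiff \<theta> (\<lambda>t. \<Sum>i\<in>{..<?rt}. (w i * v $ i) * ?f i t) k (2 * m)"
      by (subst divdiff_sum) (auto simp: sum_distrib_left left_poly_trunc_pow)
    \<comment> \<open>The knot distance cancels: if it were zero, \<open>2 * m + 1\<close>
      consecutive knots would coincide, exceeding the bound \<open>m\<close>.\<close>
    finally show ?thesis
      using open_knot_vector_run[OF okv, of k "2 * m"] k m by auto
  qed
  have inj: "inj_on (\<lambda>i. (\<kappa> i, \<nu> i)) {..<?rt}"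
    using distinct_index_pairs[of r \<mu>] len by (auto simp: \<kappa>_def \<nu>_def inj_on_def nth_eq_iff_index_eq)
  have "v $ i = 0" if i: "i < ?rt" for i
  proof -
    have "w i * v $ i = 0"
    proof (rule truncated_powers_divdiff_independent[where c = "\<lambda>i. w i * v $ i" and i = i,
          OF okv sel finite_lessThan _ _ inj zero])
      show "1 \<le> \<kappa> i \<and> \<kappa> i \<le> r" "\<nu> i < \<mu> (\<kappa> i)" if "i \<in> {..<?rt}" for i
        using \<kappa>[of i] \<nu>[of i] that by simp_all
      show "i \<in> {..<?rt}" using i by simp
    qed
    then show ?thesis using w by simp
  qed
  then show ?thesis using v by (intro eq_vecI) auto
qed

theorem lemma3p6:
  fixes m n r :: nat and a b :: real and \<theta> :: "nat \<Rightarrow> real" and l \<mu> :: "nat \<Rightarrow> nat"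
  assumes "open_knot_vector m n a b \<theta>"
    and "selected_knots m n \<theta> r l \<mu>"
  defines "rt \<equiv> (\<Sum>j = 1..r. \<mu> j)"
    and "A \<equiv> A_mat m n b \<theta> r l \<mu>"
    and "B \<equiv> B_mat m n a b \<theta> r l \<mu>"
  shows "vec_space.rank rt A = rt \<and>
    (\<forall>R \<in> carrier_mat (n - m) rt. inverts_mat A R \<longrightarrow>
       R * B \<in> carrier_mat (n - m) (n - m) \<and> A * (R * B) = B)"
proof (intro conjI ballI impI)
  have A: "A \<in> carrier_mat rt (n - m)" and B: "B \<in> carrier_mat rt (n - m)"
    unfolding A_def B_def rt_def by (rule A_mat_carrier, rule B_mat_carrier)
  show "vec_space.rank rt A = rt"
    by (rule rank_eq_dim_row[OF A])
       (use A_mat_transpose_injective[OF assms(1,2)] in \<open>simp add: A_def rt_def\<close>)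
  fix R assume R: "R \<in> carrier_mat (n - m) rt" and inv: "inverts_mat A R"
  show "R * B \<in> carrier_mat (n - m) (n - m)" using R B by simp
  have "A * (R * B) = A * R * B" using A R B by (simp add: assoc_mult_mat)
  also have "\<dots> = B" using inv A B by (simp add: inverts_mat_def)
  finally show "A * (R * B) = B" .
qed

end
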